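(* Let $f:X\to D_n(Y)$ be an $n$-valued map, where $X$ and $Y$ are finite polyhedra. Then $f$ has a proper partition if and only if there are positive integers $m$ and $l$ with $m+l=n$ such that $f_\#(\pi_1(X))$ is a subgroup of $t_{m,l\#}(B_{m,l}(Y))$.
   Context: For a topological space $Y$ and a positive integer $n$, $F_n(Y)=\{(y_1,\dots,y_n)\in Y^n \mid y_i\neq y_j \text{ for } i\neq j\}$ has the subspace topology from $Y^n$, and $D_n(Y)$, the set of unordered $n$-element subsets of $Y$, has the quotient topology from $F_n(Y)$ (forgetting the ordering). An $n$-valued map from $X$ to $Y$ is a continuous function $f:X\to D_n(Y)$; $f(x)$ is regarded as an $n$-element subset of $Y$. A partition of an $n$-valued map $f$ is a set $\{f_1,\dots,f_s\}$ where $f_i:X\to D_{k_i}(Y)$ is a $k_i$-valued map, the $k_i$ are positive integers with $k_1+\dots+k_s=n$, and $f(x)=f_1(x)\cup\dots\cup f_s(x)$ for every $x\in X$. The partition is proper if it consists of more than one map ($s\ge 2$). For positive integers $m,l$ with $m+l=n$, the mixed configuration space is $D_{m,l}(Y)=\{(\{y_1,\dots,y_m\},\{y_{m+1},\dots,y_n\}) \mid y_i\neq y_j \text{ for } i\neq j\}$, the quotient of $F_n(Y)$ by $\Sigma_m\times\Sigma_l$, where $\Sigma_d$ is the symmetric group on $d$ elements. The map $t_{m,l}:D_{m,l}(Y)\to D_n(Y)$ is the covering map $t_{m,l}(\{y_1,\dots,y_m\},\{y_{m+1},\dots,y_n\})=\{y_1,\dots,y_n\}$. The subscript $\#$ denotes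 the induced homomorphism of fundamental groups. $B_n(Y)=\pi_1(D_n(Y))$ is the $n$-strand braid group of $Y$, and $B_{m,l}(Y)=\pi_1(D_{m,l}(Y))$ is the mixed braid group, the subgroup of $B_n(Y)$ in which the strands starting in the first $m$ positions must end in the first $m$ positions, and the strands starting in the last $l$ positions must end in the last $l$ positions; the homomorphism $t_{m,l\#}:B_{m,l}(Y)\to B_n(Y)$ is the inclusion. *)

theory Defs
  imports "HOL-Analysis.Analysis" "HOL-Algebra.Group"
begin

section \<open>Configuration spaces\<close>

definition quot_topology :: "'a topology \<Rightarrow> ('a \<Rightarrow> 'b) \<Rightarrow> 'b topology" where
  "quot_topology X q =
     topology (\<lambda>U. U \<subseteq> q ` topspace X \<and> openin X {x \<in> topspace X. q x \<in> U})"

lemma openin_quot_topology: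
  "openin (quot_topology X q) U \<longleftrightarrow>
     U \<subseteq> q ` topspace X \<and> openin X {x \<in> topspace X. q x \<in> U}"
proof -
  define L where "L = (\<lambda>U. U \<subseteq> q ` topspace X \<and> openin X {x \<in> topspace X. q x \<in> U})"
  have int: "L (S \<inter> T)" if "L S" "L T" for S T
  proof -
    have "{x \<in> topspace X. q x \<in> S \<inter> T} =
        {x \<in> topspace X. q x \<in> S} \<inter> {x \<in> topspace X. q x \<in> T}"
      by blast
    moreover have "openin X ({x \<in> topspace X. q x \<in> S} \<inter> {x \<in> topspace X. q x \<in> T})"
      using that unfolding L_def by (elim conjE) (rule openin_Int)
    moreover have "S \<inter> T \<subseteq> q ` topspace X"
      using that unfolding L_def by blast
    ultimately show ?thesis
      by (simp only: L_def simp_thms)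
  qed
  have un: "L (\<Union>\<K>)" if "\<forall>K\<in>\<K>. L K" for \<K>
  proof -
    have "openin X (\<Union>((\<lambda>K. {x \<in> topspace X. q x \<in> K}) ` \<K>))"
      by (rule openin_Union) (use that in \<open>force simp: L_def\<close>)
    moreover have "\<Union>((\<lambda>K. {x \<in> topspace X. q x \<in> K}) ` \<K>) = {x \<in> topspace X. q x \<in> \<Union>\<K>}"
      by blast
    moreover have "\<Union>\<K> \<subseteq> q ` topspace X"
      using that unfolding L_def by blast
    ultimately show ?thesis
      by (simp only: L_def simp_thms)
  qed
  have "istopology L"
    unfolding istopology_def using int un by blast
  then have "openin (topology L) = L"
    by (rule topology_inverse')
  then show ?thesis
    unfolding quot_topology_def L_def by (rule fun_cong)
qed

lemma topspace_quot_topology [simp]: "topspace (quot_topology X q) = q ` topspace X"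
proof
  show "topspace (quot_topology X q) \<subseteq> q ` topspace X"
    using openin_quot_topology[of X q "topspace (quot_topology X q)"] by simp
  have "{x \<in> topspace X. q x \<in> q ` topspace X} = topspace X"
    by auto
  then have "openin (quot_topology X q) (q ` topspace X)"
    by (simp add: openin_quot_topology)
  then show "q ` topspace X \<subseteq> topspace (quot_topology X q)"
    by (rule openin_subset)
qed

lemma quotient_map_quot_topology: "quotient_map X (quot_topology X q) q"
  by (simp add: quotient_map_def openin_quot_topology)

text \<open>A tuple \<open>(y\<^sub>1, \<dots>, y\<^sub>n)\<close> is a function on the index set \<open>{..<n}\<close>, extended by
  \<^const>\<open>undefined\<close> as usual for \<^const>\<open>product_topology\<close>.\<close>

definition ordered_conf :: "nat \<Rightarrow> 'b topology \<Rightarrow> (nat \<Rightarrow> 'b) topology" where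
  "ordered_conf n Y =
     subtopology (product_topology (\<lambda>_. Y) {..<n}) {y. inj_on y {..<n}}"

definition unordered_conf :: "nat \<Rightarrow> 'b topology \<Rightarrow> 'b set topology" where
  "unordered_conf n Y = quot_topology (ordered_conf n Y) (\<lambda>y. y ` {..<n})"

definition mixed_conf :: "nat \<Rightarrow> nat \<Rightarrow> 'b topology \<Rightarrow> ('b set \<times> 'b set) topology" where
  "mixed_conf m l Y =
     quot_topology (ordered_conf (m + l) Y) (\<lambda>y. (y ` {..<m}, y ` {m..<m + l}))"

definition forget_conf :: "'b set \<times> 'b set \<Rightarrow> 'b set" where
  "forget_conf c = fst c \<union> snd c"

lemma topspace_ordered_conf:
  "topspace (ordered_conf n Y) = {y \<in> {..<n} \<rightarrow>\<^sub>E topspace Y. inj_on y {..<n}}"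
  by (auto simp: ordered_conf_def)

lemma topspace_unordered_conf:
  "topspace (unordered_conf n Y) = {A. A \<subseteq> topspace Y \<and> finite A \<and> card A = n}"
proof (intro equalityI subsetI)
  fix A assume "A \<in> topspace (unordered_conf n Y)"
  then obtain y where "y \<in> {..<n} \<rightarrow>\<^sub>E topspace Y" "inj_on y {..<n}" "A = y ` {..<n}"
    unfolding unordered_conf_def topspace_quot_topology topspace_ordered_conf by blast
  then show "A \<in> {A. A \<subseteq> topspace Y \<and> finite A \<and> card A = n}"
    using card_image[of y "{..<n}"] by (auto dest: PiE_mem)
next
  fix A assume A: "A \<in> {A. A \<subseteq> topspace Y \<and> finite A \<and> card A = n}"
  then obtain h where h: "bij_betw h {..<n} A"
    using ex_bij_betw_nat_finite[of A] unfolding lessThan_atLeast0 by blast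
  define y where "y = restrict h {..<n}"
  have y: "y ` {..<n} = A" "inj_on y {..<n}"
    using h unfolding y_def bij_betw_def by (simp_all add: inj_on_def)
  then have "y \<in> {..<n} \<rightarrow>\<^sub>E topspace Y"
    using A unfolding y_def by (intro restrict_PiE_iff[THEN iffD2]) force
  with y show "A \<in> topspace (unordered_conf n Y)"
    unfolding unordered_conf_def topspace_quot_topology topspace_ordered_conf by blast
qed

section \<open>\<open>n\<close>-valued maps and their partitions\<close>

definition nvalued_map :: "nat \<Rightarrow> 'a topology \<Rightarrow> 'b topology \<Rightarrow> ('a \<Rightarrow> 'b set) \<Rightarrow> bool" where
  "nvalued_map n X Y f \<longleftrightarrow> 0 < n \<and> continuous_map X (unordered_conf n Y) f"

text \<open>The maps of a partition are listed as \<open>g 0, \<dots>, g (s - 1)\<close>. Since the cardinalities of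
  the sets \<open>g i x\<close> add up to that of \<open>f x\<close>, these sets are pairwise disjoint and nonempty, so
  no map is listed twice (for nonempty \<open>X\<close>).\<close>

definition nvalued_partition ::
  "nat \<Rightarrow> 'a topology \<Rightarrow> 'b topology \<Rightarrow> ('a \<Rightarrow> 'b set) \<Rightarrow> nat \<Rightarrow> (nat \<Rightarrow> nat) \<Rightarrow> (nat \<Rightarrow> 'a \<Rightarrow> 'b set) \<Rightarrow> bool"
  where
  "nvalued_partition n X Y f s k g \<longleftrightarrow>
     (\<forall>i<s. nvalued_map (k i) X Y (g i)) \<and> (\<Sum>i<s. k i) = n \<and>
     (\<forall>x\<in>topspace X. f x = (\<Union>i<s. g i x))"

definition has_proper_partition ::
  "nat \<Rightarrow> 'a topology \<Rightarrow> 'b topology \<Rightarrow> ('a \<Rightarrow> 'b set) \<Rightarrow> bool" where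
  "has_proper_partition n X Y f \<longleftrightarrow> (\<exists>s k g. 2 \<le> s \<and> nvalued_partition n X Y f s k g)"

section \<open>Fundamental groups\<close>

text \<open>Loops are functions on all of \<open>\<real>\<close>, of which only the restriction to \<open>[0, 1]\<close> matters.
  The constants \<^const>\<open>homotopic_paths\<close> and \<^const>\<open>joinpaths\<close> are tied to the type class
  \<^class>\<open>topological_space\<close>, hence the versions below for abstract topologies.\<close>

definition loops_at :: "'a topology \<Rightarrow> 'a \<Rightarrow> (real \<Rightarrow> 'a) set" where
  "loops_at X x0 = {p. pathin X p \<and> p 0 = x0 \<and> p 1 = x0}"

definition loop_class :: "'a topology \<Rightarrow> 'a \<Rightarrow> (real \<Rightarrow> 'a) \<Rightarrow> (real \<Rightarrow> 'a) set" where
  "loop_class X x0 p =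
     {q. homotopic_with (\<lambda>r. r 0 = x0 \<and> r 1 = x0) (top_of_set {0..1}) X p q}"

definition join_loops :: "(real \<Rightarrow> 'a) \<Rightarrow> (real \<Rightarrow> 'a) \<Rightarrow> real \<Rightarrow> 'a" where
  "join_loops p q = (\<lambda>t. if t \<le> 1/2 then p (2 * t) else q (2 * t - 1))"

text \<open>Operations on classes are written as unions over all representatives; the classes being
  united coincide.\<close>

definition fundamental_group :: "'a topology \<Rightarrow> 'a \<Rightarrow> (real \<Rightarrow> 'a) set monoid" where
  "fundamental_group X x0 =
     \<lparr>carrier = loop_class X x0 ` loops_at X x0,
      mult = (\<lambda>P Q. \<Union>p\<in>P. \<Union>q\<in>Q. loop_class X x0 (join_loops p q)),
      one = loop_class X x0 (\<lambda>_. x0)\<rparr>"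

definition induced_hom ::
  "'b topology \<Rightarrow> ('a \<Rightarrow> 'b) \<Rightarrow> 'a \<Rightarrow> (real \<Rightarrow> 'a) set \<Rightarrow> (real \<Rightarrow> 'b) set" where
  "induced_hom Y f x0 P = (\<Union>p\<in>P. loop_class Y (f x0) (f \<circ> p))"

definition induced_image ::
  "'a topology \<Rightarrow> 'b topology \<Rightarrow> ('a \<Rightarrow> 'b) \<Rightarrow> 'a \<Rightarrow> (real \<Rightarrow> 'b) set set" where
  "induced_image X Y f x0 = induced_hom Y f x0 ` carrier (fundamental_group X x0)"

section \<open>Finite polyhedra\<close>

text \<open>This is not the predicate \<^const>\<open>polyhedron\<close> of the library, which describes convex
  polyhedra.\<close>

definition finite_polyhedron :: "'a::euclidean_space set \<Rightarrow> bool" where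
  "finite_polyhedron X \<longleftrightarrow> (\<exists>\<C>. simplicial_complex \<C> \<and> X = \<Union>\<C>)"

text \<open>A set of base points meeting every path component. If \<open>X\<close> is path connected, every
  singleton \<open>{x0}\<close> with \<open>x0 \<in> X\<close> qualifies.\<close>

definition base_points :: "'a::topological_space set \<Rightarrow> 'a set \<Rightarrow> bool" where
  "base_points X S \<longleftrightarrow> S \<subseteq> X \<and> (\<forall>x\<in>X. \<exists>x0\<in>S. path_component X x0 x)"

lemma base_points_singleton:
  "path_connected X \<Longrightarrow> x0 \<in> X \<Longrightarrow> base_points X {x0}"
  by (auto simp: base_points_def path_connected_component)

text \<open>The image of the fundamental group of \<open>X\<close> at \<open>x0\<close> under \<open>f\<close> is a subgroup of the image of
  the mixed braid group in the braid group based at \<open>f x0\<close>. The mixed braid group depends, up to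
  conjugation in the braid group, on which \<open>m\<close> of the \<open>n\<close> points of \<open>f x0\<close> are taken to be the
  first \<open>m\<close>; the existentially quantified base point \<open>c\<close> is this choice.\<close>

definition image_in_mixed_braids ::
  "nat \<Rightarrow> nat \<Rightarrow> 'a topology \<Rightarrow> 'b topology \<Rightarrow> ('a \<Rightarrow> 'b set) \<Rightarrow> 'a \<Rightarrow> bool" where
  "image_in_mixed_braids m l X Y f x0 \<longleftrightarrow>
     (\<exists>c\<in>topspace (mixed_conf m l Y). forget_conf c = f x0 \<and>
        subgroup (induced_image X (unordered_conf (m + l) Y) f x0)
          (fundamental_group (unordered_conf (m + l) Y) (f x0)
             \<lparr>carrier := induced_image (mixed_conf m l Y) (unordered_conf (m + l) Y) forget_conf c\<rparr>))"

end

theory Submission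
  imports Defs
begin

text \<open>An \<open>n\<close>-valued map \<open>f\<close> determines the \<open>n\<close>-sheeted covering \<open>fst : Sigma X f \<rightarrow> X\<close>, whose
  total space is the graph of \<open>f\<close>, and the maps of a partition correspond to unions of path
  components of the graph. If the loops of \<open>X\<close> are sent into a mixed braid group, monodromy
  preserves the chosen \<open>m\<close> points over each base point, so the path components through these points
  and the remaining ones give the two maps. Conversely, two complementary maps of a partition lift
  \<open>f\<close> to the mixed configuration space.\<close>

section \<open>Topology of configuration spaces\<close>

text \<open>Two obstacles shape the argument. The topology of a configuration space is a quotient of
  a space of tuples, so continuity of a set-valued map is hard to test directly; it is reduced to
  the openness of the sets where the values meet a given open \<open>V\<close>. In this form it
  matches the graph: such a set is the projection of an open part of the graph, and the projection
  is an open map. The other obstacle is continuity of the two maps built from path components. It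
  needs these components to be open in the graph. A finite polyhedron is locally path connected and
  the covering inherits this, so arbitrary unions of path components, and their complements, are
  open. The covering \<open>forget_conf\<close> is never lifted through. All lifting takes place in
  graphs of multivalued maps over an interval or a square, where a lift is a continuous selection of
  one value.\<close>

lemma continuous_map_ordered_conf_coord:
  assumes "i < n"
  shows "continuous_map (ordered_conf n Y) Y (\<lambda>y. y i)"
  unfolding ordered_conf_def
  by (rule continuous_map_from_subtopology, rule continuous_map_product_projection) (use assms in auto)

lemma continuous_map_ordered_conf_iff:
  "continuous_map Z (ordered_conf n Y) s \<longleftrightarrow>
     (\<forall>z\<in>topspace Z. s z \<in> extensional {..<n} \<and> inj_on (s z) {..<n}) \<and>
     (\<forall>i<n. continuous_map Z Y (\<lambda>z. s z i))"
  unfolding ordered_conf_def continuous_map_in_subtopology continuous_map_componentwise by auto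

lemma continuous_map_ordered_to_unordered:
  "continuous_map (ordered_conf n Y) (unordered_conf n Y) (\<lambda>y. y ` {..<n})"
  unfolding unordered_conf_def by (rule quotient_imp_continuous_map[OF quotient_map_quot_topology])

text \<open>Pulled back to ordered tuples, meeting \<open>V\<close> means that some coordinate lies
  in \<open>V\<close>, a union of \<open>n\<close> open conditions.\<close>

lemma openin_unordered_conf_meets:
  assumes "openin Y V"
  shows "openin (unordered_conf n Y) {A \<in> topspace (unordered_conf n Y). A \<inter> V \<noteq> {}}"
proof -
  have "{y \<in> topspace (ordered_conf n Y). y ` {..<n} \<in> {A \<in> topspace (unordered_conf n Y). A \<inter> V \<noteq> {}}}
     = (\<Union>i<n. {y \<in> topspace (ordered_conf n Y). y i \<in> V})"
    unfolding unordered_conf_def topspace_quot_topology by auto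
  moreover have "openin (ordered_conf n Y) (\<Union>i<n. {y \<in> topspace (ordered_conf n Y). y i \<in> V})"
    by (intro openin_Union)
      (auto intro: openin_continuous_map_preimage[OF continuous_map_ordered_conf_coord assms])
  ultimately show ?thesis
    unfolding unordered_conf_def openin_quot_topology by auto
qed

lemma Hausdorff_space_separate_finite:
  assumes "Hausdorff_space Y" and "finite I" and "inj_on y I" and "y ` I \<subseteq> topspace Y"
  obtains V where "\<And>i. i \<in> I \<Longrightarrow> openin Y (V i)" "\<And>i. i \<in> I \<Longrightarrow> y i \<in> V i"
    "disjoint_family_on V I"
proof -
  have "\<exists>U W. openin Y U \<and> openin Y W \<and> y i \<in> U \<and> y j \<in> W \<and> disjnt U W"
    if "i \<in> I" "j \<in> I" "i \<noteq> j" for i j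
    using assms that unfolding Hausdorff_space_def inj_on_def by (metis image_subset_iff)
  then obtain U W where UW: "\<And>i j. i \<in> I \<Longrightarrow> j \<in> I \<Longrightarrow> i \<noteq> j \<Longrightarrow>
      openin Y (U i j) \<and> openin Y (W i j) \<and> y i \<in> U i j \<and> y j \<in> W i j \<and> disjnt (U i j) (W i j)"
    by metis
  \<comment> \<open>\<open>U i j\<close> and \<open>W j i\<close> are both neighbourhoods of
    \<open>y i\<close>. Using both puts \<open>V i\<close> inside \<open>U i j\<close> and
    \<open>V j\<close> inside \<open>W i j\<close>, which are disjoint. The factor
    \<open>topspace Y\<close> covers a one-element \<open>I\<close>, where the intersection over no
    indices is the whole type.\<close>
  define V where "V i = topspace Y \<inter> (\<Inter>j\<in>I - {i}. U i j \<inter> W j i)" for i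
  show ?thesis
  proof
    show "openin Y (V i)" if "i \<in> I" for i
    proof (cases "I - {i} = {}")
      case False
      then have "openin Y (\<Inter>j\<in>I - {i}. U i j \<inter> W j i)"
        using that assms(2) UW by (intro openin_Inter) (auto intro!: openin_Int)
      then show ?thesis unfolding V_def by blast
    next
      case True
      then have "V i = topspace Y" unfolding V_def by (simp only: True) simp
      then show ?thesis by simp
    qed
    show "y i \<in> V i" if "i \<in> I" for i
      using that assms(4) UW unfolding V_def by blast
    show "disjoint_family_on V I"
      unfolding disjoint_family_on_def
    proof (intro ballI impI)
      fix i j assume ij: "i \<in> I" "j \<in> I" "i \<noteq> j"
      then have "V i \<subseteq> U i j" "V j \<subseteq> W i j"
        unfolding V_def by auto
      with UW[OF ij] show "V i \<inter> V j = {}"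
        unfolding disjnt_def by blast
    qed
  qed
qed

text \<open>The points of \<open>F z0\<close> are put into disjoint open sets \<open>V i\<close>.
  Where \<open>F z\<close> still meets all of them, its \<open>n\<close> points are distributed one
  to each, so the index \<open>i\<close> of \<open>V i\<close> orders them. The hypothesis is
  \<open>meets\<close> rather than continuity because the lemma also serves to prove that
  \<open>meets\<close> implies continuity.\<close>

lemma unordered_conf_local_lift:
  assumes "Hausdorff_space Y"
    and F: "\<And>z. z \<in> topspace Z \<Longrightarrow> F z \<in> topspace (unordered_conf n Y)"
    and meets: "\<And>V. openin Y V \<Longrightarrow> openin Z {z \<in> topspace Z. F z \<inter> V \<noteq> {}}"
    and z0: "z0 \<in> topspace Z"
  obtains U V s where "openin Z U" "z0 \<in> U" "\<And>i. i < n \<Longrightarrow> openin Y (V i)"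
    "disjoint_family_on V {..<n}" "continuous_map (subtopology Z U) (ordered_conf n Y) s"
    "\<And>z. z \<in> U \<Longrightarrow> s z ` {..<n} = F z"
    "\<And>z i. z \<in> U \<Longrightarrow> i < n \<Longrightarrow> F z \<inter> V i = {s z i}"
proof -
  have "F z0 \<in> topspace (unordered_conf n Y)" using F z0 .
  then obtain y where y: "y \<in> {..<n} \<rightarrow>\<^sub>E topspace Y" "inj_on y {..<n}" "F z0 = y ` {..<n}"
    unfolding unordered_conf_def topspace_quot_topology topspace_ordered_conf by blast
  obtain V where V: "\<And>i. i \<in> {..<n} \<Longrightarrow> openin Y (V i)" "\<And>i. i \<in> {..<n} \<Longrightarrow> y i \<in> V i"
    "disjoint_family_on V {..<n}"
    using Hausdorff_space_separate_finite[OF assms(1) _ y(2)] y(1) by blast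
  define U where "U = topspace Z \<inter> (\<Inter>i<n. {z \<in> topspace Z. F z \<inter> V i \<noteq> {}})"
  have "openin Z U"
  \<comment> \<open>For \<open>n = 0\<close> the intersection has no members and \<open>U\<close> is
    all of \<open>topspace Z\<close>; \<open>openin_Inter\<close> covers only nonempty
    families.\<close>
  proof (cases "n = 0")
    case False
    then have "openin Z (\<Inter>i<n. {z \<in> topspace Z. F z \<inter> V i \<noteq> {}})"
      using V(1) meets by (intro openin_Inter) auto
    then show ?thesis unfolding U_def by blast
  qed (simp add: U_def)
  have "\<exists>t. t ` {..<n} = F z \<and> inj_on t {..<n} \<and> t \<in> extensional {..<n} \<and> (\<forall>i<n. F z \<inter> V i = {t i})"
    if z: "z \<in> U" for z
  proof -
    have "\<forall>i\<in>{..<n}. \<exists>y. y \<in> F z \<inter> V i" using z unfolding U_def by blast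
    then obtain t0 where t0: "\<forall>i\<in>{..<n}. t0 i \<in> F z \<inter> V i" by metis
    define t where "t = restrict t0 {..<n}"
    have t: "t i \<in> F z" "t i \<in> V i" if "i < n" for i using t0 that unfolding t_def by auto
    have inj: "inj_on t {..<n}"
      using t V(3) unfolding inj_on_def disjoint_family_on_def by (metis IntI empty_iff lessThan_iff)
    have c: "finite (F z)" "card (F z) = n"
      using F[of z] z unfolding U_def topspace_unordered_conf by auto
    have im: "t ` {..<n} = F z"
      by (rule card_subset_eq) (use t c inj in \<open>auto simp: card_image\<close>)
    have "F z \<inter> V i = {t i}" if "i < n" for i
    proof -
      have "x = t i" if x: "x \<in> F z" "x \<in> V i" for x
      proof -
        obtain j where "j < n" "x = t j" using x im by blast
        moreover have "j = i"
          using calculation \<open>i < n\<close> t(2)[of j] x V(3) unfolding disjoint_family_on_def by blast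
        ultimately show ?thesis by simp
      qed
      then show ?thesis using t[OF that] by blast
    qed
    with im inj show ?thesis by (intro exI[of _ t]) (simp add: t_def)
  qed
  then obtain s where s: "\<And>z. z \<in> U \<Longrightarrow> s z ` {..<n} = F z"
    "\<And>z. z \<in> U \<Longrightarrow> inj_on (s z) {..<n}" "\<And>z. z \<in> U \<Longrightarrow> s z \<in> extensional {..<n}"
    "\<And>z i. z \<in> U \<Longrightarrow> i < n \<Longrightarrow> F z \<inter> V i = {s z i}"
    by metis
  have cont: "continuous_map (subtopology Z U) (ordered_conf n Y) s"
    unfolding continuous_map_ordered_conf_iff
  proof (intro conjI ballI allI impI)
    fix i assume i: "i < n"
    show "continuous_map (subtopology Z U) Y (\<lambda>z. s z i)"
      unfolding continuous_map_def
    proof (intro conjI allI impI)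
      show "(\<lambda>z. s z i) \<in> topspace (subtopology Z U) \<rightarrow> topspace Y"
        using s(1) F i by (fastforce simp: topspace_unordered_conf)
      fix T assume T: "openin Y T"
      \<comment> \<open>This turns a preimage under the \<open>i\<close>-th coordinate into a set of
        the form handled by \<open>meets\<close>.\<close>
      have "s z i \<in> T \<longleftrightarrow> F z \<inter> (V i \<inter> T) \<noteq> {}" if "z \<in> U" for z
      proof -
        have "F z \<inter> (V i \<inter> T) = {s z i} \<inter> T" using s(4)[OF that i] by blast
        then show ?thesis by simp
      qed
      then have "{z \<in> topspace (subtopology Z U). s z i \<in> T}
          = U \<inter> {z \<in> topspace Z. F z \<inter> (V i \<inter> T) \<noteq> {}}"
        by auto
      moreover have "openin Z {z \<in> topspace Z. F z \<inter> (V i \<inter> T) \<noteq> {}}"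
        using T V(1) i by (intro meets openin_Int) auto
      ultimately show "openin (subtopology Z U) {z \<in> topspace (subtopology Z U). s z i \<in> T}"
        by (auto simp: openin_subtopology)
    qed
  qed (use s in auto)
  have "z0 \<in> U" using z0 V(2) y(3) unfolding U_def by auto
  show ?thesis
    by (rule that[of U V s]) (use \<open>z0 \<in> U\<close> \<open>openin Z U\<close> cont s V in simp_all)
qed

lemma continuous_map_locally:
  assumes "\<And>z. z \<in> topspace Z \<Longrightarrow> \<exists>U. openin Z U \<and> z \<in> U \<and> continuous_map (subtopology Z U) Y f"
  shows "continuous_map Z Y f"
  unfolding continuous_map_eq_topcontinuous_at topcontinuous_at_def
proof (intro ballI conjI allI impI)
  show "f \<in> topspace Z \<rightarrow> topspace Y"
    using assms by (fastforce simp: continuous_map_def dest: openin_subset)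
  fix z V assume z: "z \<in> topspace Z" and V: "openin Y V \<and> f z \<in> V"
  obtain U where U: "openin Z U" "z \<in> U" "continuous_map (subtopology Z U) Y f"
    using assms z by blast
  have "openin (subtopology Z U) {w \<in> topspace (subtopology Z U). f w \<in> V}"
    using U(3) V by (blast intro: openin_continuous_map_preimage)
  then have "openin Z {w \<in> topspace (subtopology Z U). f w \<in> V}"
    using U(1) openin_trans_full by blast
  then show "\<exists>U. openin Z U \<and> z \<in> U \<and> (\<forall>y\<in>U. f y \<in> V)"
    using z U V by (intro exI[of _ "{w \<in> topspace (subtopology Z U). f w \<in> V}"]) auto
qed

text \<open>For configurations of fixed cardinality in a Hausdorff space, lower semicontinuity already
  implies continuity: disjoint neighbourhoods of the points of \<open>F z\<close> leave room for just one point
  each.\<close>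

lemma continuous_map_unordered_conf_iff:
  assumes "Hausdorff_space Y"
  shows "continuous_map Z (unordered_conf n Y) F \<longleftrightarrow>
    (\<forall>z\<in>topspace Z. F z \<in> topspace (unordered_conf n Y)) \<and>
    (\<forall>V. openin Y V \<longrightarrow> openin Z {z \<in> topspace Z. F z \<inter> V \<noteq> {}})" (is "?L \<longleftrightarrow> ?R")
proof
  assume L: ?L
  show ?R
  proof (intro conjI ballI allI impI)
    show "F z \<in> topspace (unordered_conf n Y)" if "z \<in> topspace Z" for z
      using L that by (auto simp: continuous_map_def)
    then have eq: "{z \<in> topspace Z. F z \<inter> V \<noteq> {}}
        = {z \<in> topspace Z. F z \<in> {A \<in> topspace (unordered_conf n Y). A \<inter> V \<noteq> {}}}" for V
      by auto
    show "openin Z {z \<in> topspace Z. F z \<inter> V \<noteq> {}}" if "openin Y V" for V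
      unfolding eq by (rule openin_continuous_map_preimage[OF L openin_unordered_conf_meets[OF that]])
  qed
next
  assume R: ?R
  show ?L
  proof (rule continuous_map_locally)
    fix z assume "z \<in> topspace Z"
    then obtain U V s where *: "openin Z U" "z \<in> U" 
      "continuous_map (subtopology Z U) (ordered_conf n Y) s" "\<And>z. z \<in> U \<Longrightarrow> s z ` {..<n} = F z"
      using unordered_conf_local_lift[OF assms, of Z F n z] R by (metis (no_types, lifting))
    have "continuous_map (subtopology Z U) (unordered_conf n Y) ((\<lambda>y. y ` {..<n}) \<circ> s)"
      by (rule continuous_map_compose[OF *(3) continuous_map_ordered_to_unordered])
    then have "continuous_map (subtopology Z U) (unordered_conf n Y) F"
      by (rule continuous_map_eq) (use *(4) in auto)
    with * show "\<exists>U. openin Z U \<and> z \<in> U \<and> continuous_map (subtopology Z U) (unordered_conf n Y) F"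
      by blast
  qed
qed


section \<open>Pairs of disjoint configurations and the mixed configuration space\<close>

lemma concat_tuples:
  fixes a b :: "nat \<Rightarrow> 'b"
  assumes "inj_on a {..<m}" "inj_on b {..<l}" "a ` {..<m} \<inter> b ` {..<l} = {}"
  defines "y \<equiv> (\<lambda>i\<in>{..<m+l}. if i < m then a i else b (i - m))"
  shows "inj_on y {..<m+l}" "y ` {..<m} = a ` {..<m}" "y ` {m..<m+l} = b ` {..<l}"
proof -
  show "y ` {..<m} = a ` {..<m}" by (auto simp: y_def)
  have "{m..<m+l} = (\<lambda>i. i + m) ` {..<l}"
    by (simp add: lessThan_atLeast0 add.commute)
  then show "y ` {m..<m+l} = b ` {..<l}"
  proof -
    assume eq: "{m..<m+l} = (\<lambda>i. i + m) ` {..<l}"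
    show ?thesis
      unfolding eq image_image by (rule image_cong) (auto simp: y_def)
  qed
  show "inj_on y {..<m+l}"
  proof (rule linorder_inj_onI')
    fix i j assume ij: "i \<in> {..<m+l}" "j \<in> {..<m+l}" "i < j"
    consider "j < m" | "i < m" "m \<le> j" | "m \<le> i" by linarith
    then show "y i \<noteq> y j"
    proof cases
      case 1
      then show ?thesis using ij assms(1) by (auto simp: y_def dest: inj_onD)
    next
      case 2
      then have "a i \<in> a ` {..<m}" "b (j - m) \<in> b ` {..<l}" using ij by auto
      then show ?thesis using 2 ij assms(3) by (auto simp: y_def)
    next
      case 3
      then have "i - m \<noteq> j - m" "i - m < l" "j - m < l"
        using ij by auto
      then have "b (i - m) \<noteq> b (j - m)"
        using inj_onD[OF assms(2), of "i - m" "j - m"] by auto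
      then show ?thesis using 3 ij by (simp add: y_def)
    qed
  qed
qed

text \<open>The mixed configuration space is a quotient of the space of
  \<open>(m + l)\<close>-tuples, not a subspace of a product, so continuity of the two components
  does not give that of the pair at once. Both components are lifted locally to tuples, and
  disjointness makes the concatenated tuple injective.\<close>

lemma continuous_map_mixed_conf_Pair:
  assumes Y: "Hausdorff_space Y"
    and G: "continuous_map Z (unordered_conf m Y) G"
    and H: "continuous_map Z (unordered_conf l Y) H"
    and disj: "\<And>z. z \<in> topspace Z \<Longrightarrow> G z \<inter> H z = {}"
  shows "continuous_map Z (mixed_conf m l Y) (\<lambda>z. (G z, H z))"
proof (rule continuous_map_locally)
  fix z assume z: "z \<in> topspace Z"
  have G': "\<And>z. z \<in> topspace Z \<Longrightarrow> G z \<in> topspace (unordered_conf m Y)"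
    "\<And>V. openin Y V \<Longrightarrow> openin Z {z \<in> topspace Z. G z \<inter> V \<noteq> {}}"
    and H': "\<And>z. z \<in> topspace Z \<Longrightarrow> H z \<in> topspace (unordered_conf l Y)"
    "\<And>V. openin Y V \<Longrightarrow> openin Z {z \<in> topspace Z. H z \<inter> V \<noteq> {}}"
    using G H unfolding continuous_map_unordered_conf_iff[OF Y] by blast+
  obtain U s where s: "openin Z U" "z \<in> U" "continuous_map (subtopology Z U) (ordered_conf m Y) s"
      "\<And>z. z \<in> U \<Longrightarrow> s z ` {..<m} = G z"
    by (rule unordered_conf_local_lift[OF Y G' z]) blast+
  obtain W t where t: "openin Z W" "z \<in> W" "continuous_map (subtopology Z W) (ordered_conf l Y) t"
      "\<And>z. z \<in> W \<Longrightarrow> t z ` {..<l} = H z"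
    by (rule unordered_conf_local_lift[OF Y H' z]) blast+
  define y where "y z = (\<lambda>i\<in>{..<m+l}. if i < m then s z i else t z (i - m))" for z
  let ?Z = "subtopology Z (U \<inter> W)"
  have inj: "inj_on (s z) {..<m}" "inj_on (t z) {..<l}" if "z \<in> topspace ?Z" for z
    using s(3) t(3) that unfolding continuous_map_ordered_conf_iff by auto
  have y: "inj_on (y z) {..<m+l}" "y z ` {..<m} = G z" "y z ` {m..<m+l} = H z"
    if "z \<in> topspace ?Z" for z
    using concat_tuples[OF inj[OF that]] disj s(4) t(4) that unfolding y_def by auto
  have "continuous_map ?Z Y (\<lambda>z. y z i)" if i: "i < m + l" for i
  proof (cases "i < m")
    case True
    then have "continuous_map (subtopology Z U) Y (\<lambda>z. s z i)"
      using s(3) unfolding continuous_map_ordered_conf_iff by blast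
    then have "continuous_map ?Z Y (\<lambda>z. s z i)"
      using continuous_map_from_subtopology_mono by blast
    with True i show ?thesis by (simp add: y_def)
  next
    case False
    then have "continuous_map (subtopology Z W) Y (\<lambda>z. t z (i - m))"
      using t(3) i unfolding continuous_map_ordered_conf_iff by auto
    then have "continuous_map ?Z Y (\<lambda>z. t z (i - m))"
      using continuous_map_from_subtopology_mono by blast
    with False i show ?thesis by (simp add: y_def)
  qed
  then have "continuous_map ?Z (ordered_conf (m + l) Y) y"
    using y(1) unfolding continuous_map_ordered_conf_iff by (auto simp: y_def)
  then have "continuous_map ?Z (mixed_conf m l Y) ((\<lambda>y. (y ` {..<m}, y ` {m..<m + l})) \<circ> y)"
    unfolding mixed_conf_def
    by (rule continuous_map_compose[OF _ quotient_imp_continuous_map[OF quotient_map_quot_topology]])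
  then have "continuous_map ?Z (mixed_conf m l Y) (\<lambda>z. (G z, H z))"
    by (rule continuous_map_eq) (simp add: y)
  then show "\<exists>U. openin Z U \<and> z \<in> U \<and> continuous_map (subtopology Z U) (mixed_conf m l Y) (\<lambda>z. (G z, H z))"
    using s(1,2) t(1,2) by blast
qed

text \<open>On tuples this is restriction to the first \<open>m\<close> coordinates. It makes the
  first \<open>m\<close> strands of a mixed loop an \<open>m\<close>-valued map of the time
  parameter.\<close>

lemma continuous_map_mixed_conf_fst:
  "continuous_map (mixed_conf m l Y) (unordered_conf m Y) fst"
  unfolding mixed_conf_def
proof (rule continuous_compose_quotient_map[OF quotient_map_quot_topology])
  have eq: "fst \<circ> (\<lambda>y. (y ` {..<m}, y ` {m..<m + l})) = (\<lambda>y. y ` {..<m}) \<circ> (\<lambda>y. restrict y {..<m})"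
    by auto
  have "continuous_map (ordered_conf (m + l) Y) (ordered_conf m Y) (\<lambda>y. restrict y {..<m})"
    unfolding continuous_map_ordered_conf_iff
    by (auto simp: topspace_ordered_conf intro: inj_on_subset continuous_map_ordered_conf_coord)
  then show "continuous_map (ordered_conf (m + l) Y) (unordered_conf m Y)
      (fst \<circ> (\<lambda>y. (y ` {..<m}, y ` {m..<m + l})))"
    unfolding eq by (rule continuous_map_compose[OF _ continuous_map_ordered_to_unordered])
qed

lemma continuous_map_forget_conf:
  "continuous_map (mixed_conf m l Y) (unordered_conf (m + l) Y) forget_conf"
  unfolding mixed_conf_def
proof (rule continuous_compose_quotient_map[OF quotient_map_quot_topology])
  have "{..<m + l} = {..<m} \<union> {m..<m + l}"
    by auto
  then have "forget_conf \<circ> (\<lambda>y. (y ` {..<m}, y ` {m..<m + l})) = (\<lambda>y :: nat \<Rightarrow> 'a. y ` {..<m + l})"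
    by (auto simp: forget_conf_def fun_eq_iff)
  then show "continuous_map (ordered_conf (m + l) Y) (unordered_conf (m + l) Y)
      (forget_conf \<circ> (\<lambda>y. (y ` {..<m}, y ` {m..<m + l})))"
    using continuous_map_ordered_to_unordered by simp
qed

section \<open>The covering space associated with an \<open>n\<close>-valued map\<close>

lemma nvalued_mapD:
  assumes "nvalued_map n X Y f" "x \<in> topspace X"
  shows "f x \<subseteq> topspace Y" "finite (f x)" "card (f x) = n" "f x \<noteq> {}"
proof -
  have "f x \<in> topspace (unordered_conf n Y)" "0 < n"
    using assms by (auto simp: nvalued_map_def continuous_map_def)
  then show "f x \<subseteq> topspace Y" "finite (f x)" "card (f x) = n" "f x \<noteq> {}"
    by (auto simp: topspace_unordered_conf)
qed

lemma nvalued_map_compose: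
  "nvalued_map n X Y f \<Longrightarrow> continuous_map Z X g \<Longrightarrow> nvalued_map n Z Y (\<lambda>z. f (g z))"
  unfolding nvalued_map_def using continuous_map_compose[of Z X g "unordered_conf n Y" f]
  by (simp add: o_def)

lemma nvalued_mapI:
  assumes "Hausdorff_space Y" "0 < n"
    and "\<And>x. x \<in> topspace X \<Longrightarrow> f x \<subseteq> topspace Y \<and> finite (f x) \<and> card (f x) = n"
    and "\<And>V. openin Y V \<Longrightarrow> openin X {x \<in> topspace X. f x \<inter> V \<noteq> {}}"
  shows "nvalued_map n X Y f"
  using assms unfolding nvalued_map_def continuous_map_unordered_conf_iff[OF assms(1)]
  by (auto simp: topspace_unordered_conf)

lemma nvalued_map_openin_meets:
  assumes "nvalued_map n X Y f" "Hausdorff_space Y" "openin Y V"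
  shows "openin X {x \<in> topspace X. f x \<inter> V \<noteq> {}}"
  using assms unfolding nvalued_map_def continuous_map_unordered_conf_iff[OF assms(2)] by blast

text \<open>Over the domain \<open>U\<close> of a local lift, the sheets are the parts of the graph
  with values in the disjoint sets \<open>V i\<close>, and \<open>z\<close> goes back to
  \<open>(z, s z i)\<close>. Surjectivity of the projection rests on \<open>0 < n\<close>, which is
  part of \<open>nvalued_map\<close>.\<close>

lemma covering_space_fst_Sigma:
  fixes Z :: "'a::topological_space set" and Y :: "'b::metric_space set"
  assumes F: "nvalued_map n (top_of_set Z) (top_of_set Y) F"
  shows "covering_space (Sigma Z F) fst Z"
proof
  have Y: "Hausdorff_space (top_of_set Y)"
    by (simp add: Hausdorff_space_subtopology)
  have FY: "F z \<subseteq> Y" "F z \<noteq> {}" if "z \<in> Z" for z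
    using nvalued_mapD[OF F, of z] that by auto
  have F': "\<And>z. z \<in> topspace (top_of_set Z) \<Longrightarrow> F z \<in> topspace (unordered_conf n (top_of_set Y))"
    "\<And>V. openin (top_of_set Y) V \<Longrightarrow>
      openin (top_of_set Z) {z \<in> topspace (top_of_set Z). F z \<inter> V \<noteq> {}}"
    using F unfolding nvalued_map_def continuous_map_unordered_conf_iff[OF Y] by blast+
  show "continuous_on (Sigma Z F) fst"
    by (rule continuous_on_fst[OF continuous_on_id])
  show "fst ` Sigma Z F = Z"
    using FY by force
  fix x assume "x \<in> Z"
  then have x: "x \<in> topspace (top_of_set Z)" by simp
  obtain U V s where U: "openin (top_of_set Z) U" "x \<in> U"
    and V: "\<And>i. i < n \<Longrightarrow> openin (top_of_set Y) (V i)" "disjoint_family_on V {..<n}"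
    and s: "continuous_map (subtopology (top_of_set Z) U) (ordered_conf n (top_of_set Y)) s"
      "\<And>z. z \<in> U \<Longrightarrow> s z ` {..<n} = F z" 
    and sV: "\<And>z i. z \<in> U \<Longrightarrow> i < n \<Longrightarrow> F z \<inter> V i = {s z i}"
    by (rule unordered_conf_local_lift[OF Y F' x]) blast+
  have UZ: "U \<subseteq> Z" using U(1) by (rule openin_imp_subset)
  have cs: "continuous_on U (\<lambda>z. s z i)" if "i < n" for i
  proof -
    have "continuous_map (subtopology (top_of_set Z) U) (top_of_set Y) (\<lambda>z. s z i)"
      using s(1) that unfolding continuous_map_ordered_conf_iff by blast
    then show ?thesis
      using UZ by (auto simp: subtopology_subtopology inf.absorb2 continuous_map_in_subtopology)
  qed
  define u where "u i = Sigma Z F \<inter> U \<times> V i" for i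
  show "\<exists>T. x \<in> T \<and> openin (top_of_set Z) T \<and>
      (\<exists>v. \<Union>v = Sigma Z F \<inter> fst -` T \<and> (\<forall>u\<in>v. openin (top_of_set (Sigma Z F)) u) \<and>
        pairwise disjnt v \<and> (\<forall>u\<in>v. Ex (homeomorphism u T fst)))"
  proof (intro exI[of _ U] exI[of _ "u ` {..<n}"] conjI ballI)
    show "x \<in> U" "openin (top_of_set Z) U" by fact+
    show "\<Union>(u ` {..<n}) = Sigma Z F \<inter> fst -` U"
    proof (intro equalityI subsetI)
      fix e assume e: "e \<in> Sigma Z F \<inter> fst -` U"
      then obtain z y where zy: "e = (z, y)" "z \<in> U" "y \<in> F z" by auto
      then obtain i where "i < n" "y = s z i" using s(2) by blast
      then show "e \<in> \<Union>(u ` {..<n})"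
        using sV[OF zy(2)] zy e unfolding u_def by blast
    qed (auto simp: u_def)
    show "pairwise disjnt (u ` {..<n})"
    proof (rule pairwiseI)
      fix a b assume "a \<in> u ` {..<n}" "b \<in> u ` {..<n}" "a \<noteq> b"
      then obtain i j where ij: "i \<in> {..<n}" "j \<in> {..<n}" "a = u i" "b = u j" by blast
      with \<open>a \<noteq> b\<close> have "V i \<inter> V j = {}"
        using disjoint_family_onD[OF V(2), of i j] by blast
      then show "disjnt a b"
        unfolding ij u_def disjnt_def by blast
    qed
    fix w assume "w \<in> u ` {..<n}"
    then obtain i where i: "i < n" "w = u i" by blast
    obtain U' where U': "open U'" "U = Z \<inter> U'" using U(1) unfolding openin_open by blast
    obtain V' where V': "open V'" "V i = Y \<inter> V'" using V(1)[OF i(1)] unfolding openin_open by blast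
    have "w = Sigma Z F \<inter> U' \<times> V'"
      using FY(1) U'(2) V'(2) unfolding i u_def by auto
    then show "openin (top_of_set (Sigma Z F)) w"
      using U'(1) V'(1) by (simp add: openin_open_Int open_Times)
    have "homeomorphism w U fst (\<lambda>z. (z, s z i))"
      unfolding homeomorphism_def
    proof (intro conjI ballI)
      show "continuous_on w fst" by (rule continuous_on_fst[OF continuous_on_id])
      show "continuous_on U (\<lambda>z. (z, s z i))"
        by (intro continuous_on_Pair continuous_on_id cs i)
      have si: "(z, s z i) \<in> w" if "z \<in> U" for z
        using sV[OF that i(1)] that UZ unfolding i u_def by blast
      then show "fst ` w = U"
        unfolding i u_def by force
      show inv: "(fst e, s (fst e) i) = e" if "e \<in> w" for e
      proof -
        have "fst e \<in> U" "snd e \<in> F (fst e) \<inter> V i" using that unfolding i u_def by auto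
        then show ?thesis using sV[OF _ i(1)] by (metis prod.collapse singletonD)
      qed
      show "(\<lambda>z. (z, s z i)) ` U = w"
      proof
        show "w \<subseteq> (\<lambda>z. (z, s z i)) ` U"
        proof
          fix e assume e: "e \<in> w"
          then have "fst e \<in> U" unfolding i u_def by auto
          then show "e \<in> (\<lambda>z. (z, s z i)) ` U" using inv[OF e] by (intro image_eqI[of _ _ "fst e"]) auto
        qed
      qed (use si in auto)
    qed simp
    then show "Ex (homeomorphism w U fst)" by blast
  qed
qed

section \<open>Continuous selections and transport along paths\<close>

text \<open>Paired with its argument, a selection is a lift of the identity of \<open>Z\<close> to
  the graph, and lifts from a connected space that agree at one point are equal.\<close>

lemma section_unique:
  fixes Z :: "'a::real_normed_vector set" and Y :: "'b::real_normed_vector set"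
  assumes F: "nvalued_map n (top_of_set Z) (top_of_set Y) F"
    and Z: "connected Z"
    and s: "continuous_on Z s" "\<And>z. z \<in> Z \<Longrightarrow> s z \<in> F z"
    and t: "continuous_on Z t" "\<And>z. z \<in> Z \<Longrightarrow> t z \<in> F z"
    and a: "a \<in> Z" "s a = t a" and z: "z \<in> Z"
  shows "s z = t z"
proof -
  have "(\<lambda>z. (z, s z)) z = (\<lambda>z. (z, t z)) z"
    by (rule covering_space_lift_unique[OF covering_space_fst_Sigma[OF F], of _ a _ Z id])
      (use assms in \<open>auto intro!: continuous_intros\<close>)
  then show ?thesis by simp
qed

text \<open>The identity of \<open>Z\<close> is lifted to the graph by the lifting criterion for
  simply connected, locally path connected spaces. It is needed for the unit interval and the unit
  square.\<close>

lemma section_exists: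
  fixes Z :: "'a::real_normed_vector set" and Y :: "'b::real_normed_vector set"
  assumes F: "nvalued_map n (top_of_set Z) (top_of_set Y) F"
    and Z: "simply_connected Z" "locally path_connected Z"
    and a: "a \<in> Z" "y \<in> F a"
  obtains s where "continuous_on Z s" "\<And>z. z \<in> Z \<Longrightarrow> s z \<in> F z" "s a = y"
proof -
  have "(a, y) \<in> Sigma Z F" using a by simp
  obtain g where g: "continuous_on Z g" "g \<in> Z \<rightarrow> Sigma Z F" "g a = (a, y)"
    "\<And>z. z \<in> Z \<Longrightarrow> fst (g z) = id z"
    by (rule covering_space_lift_strong[OF covering_space_fst_Sigma[OF F] \<open>(a, y) \<in> Sigma Z F\<close> a(1) Z, of id])
      auto
  show ?thesis
  proof
    show "continuous_on Z (\<lambda>z. snd (g z))" by (intro continuous_intros g)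
    show "snd (g z) \<in> F z" if "z \<in> Z" for z
      using g(2,4) that by (metis PiE SigmaE fst_conv id_apply snd_conv)
    show "snd (g a) = y" by (simp add: g)
  qed
qed

lemma path_component_fst_Sigma:
  assumes "path_component (Sigma X f) p q"
  shows "path_component X (fst p) (fst q)"
proof -
  obtain g where g: "path g" "path_image g \<subseteq> Sigma X f" "pathstart g = p" "pathfinish g = q"
    using assms unfolding path_component_def by blast
  have "path (fst \<circ> g)" 
    using g(1) by (rule path_continuous_image) (rule continuous_on_fst[OF continuous_on_id])
  moreover have "path_image (fst \<circ> g) \<subseteq> X"
    using g(2) by (auto simp: path_image_def)
  ultimately show ?thesis
    unfolding path_component_def using g(3,4)
    by (intro exI[of _ "fst \<circ> g"]) (auto simp: pathstart_def pathfinish_def)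
qed

text \<open>Pulling \<open>f\<close> back along a path gives a multivalued map on the unit interval;
  \<theta> sends a value at the start to the end of the selection through it.\<close>

lemma path_transport:
  fixes X :: "'a::real_normed_vector set" and Y :: "'b::real_normed_vector set"
  assumes f: "nvalued_map n (top_of_set X) (top_of_set Y) f"
    and "path_component X x0 x"
  obtains \<theta> where "bij_betw \<theta> (f x0) (f x)"
    "\<And>y. y \<in> f x0 \<Longrightarrow> path_component (Sigma X f) (x0, y) (x, \<theta> y)"
proof -
  obtain g where g: "path g" "path_image g \<subseteq> X" "pathstart g = x0" "pathfinish g = x"
    using assms(2) unfolding path_component_def by blast
  have g01: "g 0 = x0" "g 1 = x" using g(3,4) by (auto simp: pathstart_def pathfinish_def)
  have cg: "continuous_on {0..1} g" "g ` {0..1} \<subseteq> X"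
    using g(1,2) by (auto simp: path_def path_image_def)
  have F: "nvalued_map n (top_of_set {0..1}) (top_of_set Y) (\<lambda>t. f (g t))"
    by (rule nvalued_map_compose[OF f]) (use cg in \<open>auto simp: continuous_map_in_subtopology\<close>)
  have sc: "simply_connected {0..1::real}" "locally path_connected {0..1::real}"
    by (simp_all add: convex_imp_simply_connected convex_imp_locally_path_connected)
  have "\<exists>s. continuous_on {0..1} s \<and> (\<forall>t\<in>{0..1}. s t \<in> f (g t)) \<and> s 0 = y" if "y \<in> f x0" for y
  proof -
    have "0 \<in> {0..1::real}" "y \<in> f (g 0)" using that g01 by auto
    then show ?thesis by (rule section_exists[OF F sc]) blast
  qed
  then obtain s where s: "\<And>y. y \<in> f x0 \<Longrightarrow> continuous_on {0..1} (s y)"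
    "\<And>y t. y \<in> f x0 \<Longrightarrow> t \<in> {0..1} \<Longrightarrow> s y t \<in> f (g t)" "\<And>y. y \<in> f x0 \<Longrightarrow> s y 0 = y"
    by metis
  define \<theta> where "\<theta> y = s y 1" for y
  have "x0 \<in> X" "x \<in> X" using cg(2) g01 by force+
  then have fin: "finite (f x)" "card (f x0) = n" "card (f x) = n"
    using nvalued_mapD[OF f] by auto
  have inj: "inj_on \<theta> (f x0)"
  proof (rule inj_onI)
    fix y z assume yz: "y \<in> f x0" "z \<in> f x0" "\<theta> y = \<theta> z"
    \<comment> \<open>Uniqueness is applied backwards in time: the two selections agree at
      \<open>1\<close>. Surjectivity of \<theta> then follows by counting, since both fibres have
      \<open>n\<close> points.\<close>
    have "s y 0 = s z 0"
      by (rule section_unique[OF F, where a=1]) (use yz s in \<open>auto simp: \<theta>_def\<close>)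
    then show "y = z" using s(3) yz by simp
  qed
  have "\<theta> ` f x0 \<subseteq> f x" using s(2)[of _ 1] g01 by (auto simp: \<theta>_def)
  with inj fin have "bij_betw \<theta> (f x0) (f x)"
    by (simp add: bij_betw_def card_image card_subset_eq)
  moreover have "path_component (Sigma X f) (x0, y) (x, \<theta> y)" if "y \<in> f x0" for y
    unfolding path_component_def
  proof (intro exI conjI)
    show "path (\<lambda>t. (g t, s y t))"
      unfolding path_def by (intro continuous_on_Pair cg s that)
    show "path_image (\<lambda>t. (g t, s y t)) \<subseteq> Sigma X f"
      using s(2)[OF that] cg(2) unfolding path_image_def by blast
  qed (use s(3)[OF that] g01 in \<open>simp_all add: pathstart_def pathfinish_def \<theta>_def\<close>)
  ultimately show ?thesis using that by blast
qed

section \<open>Parts of the graph that are again graphs of multivalued maps\<close>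

text \<open>The points where \<open>g\<close> meets \<open>V\<close> form the projection of an open
  subset of the graph of \<open>f\<close>, and a covering projection is open.\<close>

lemma nvalued_map_of_openin_Sigma:
  fixes X :: "'a::metric_space set" and Y :: "'b::metric_space set"
  assumes f: "nvalued_map n (top_of_set X) (top_of_set Y) f"
    and op: "openin (top_of_set (Sigma X f)) (Sigma X g)"
    and card: "\<And>x. x \<in> X \<Longrightarrow> g x \<subseteq> f x \<and> card (g x) = m" and "0 < m"
  shows "nvalued_map m (top_of_set X) (top_of_set Y) g"
proof (rule nvalued_mapI)
  show "Hausdorff_space (top_of_set Y)"
    by (simp add: Hausdorff_space_subtopology)
  show "g x \<subseteq> topspace (top_of_set Y) \<and> finite (g x) \<and> card (g x) = m" if "x \<in> topspace (top_of_set X)" for x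
    using nvalued_mapD[OF f that] card that finite_subset[of "g x" "f x"] by auto
  fix V assume "openin (top_of_set Y) V"
  then obtain V' where V': "open V'" "V = Y \<inter> V'" unfolding openin_open by blast
  have gY: "g x \<subseteq> Y" if "x \<in> X" for x
    using nvalued_mapD[OF f] card that by fastforce
  have "openin (top_of_set (Sigma X f)) (Sigma X f \<inter> UNIV \<times> V')"
    by (intro openin_open_Int open_Times open_UNIV V')
  then have "openin (top_of_set (Sigma X f)) (Sigma X g \<inter> (Sigma X f \<inter> UNIV \<times> V'))"
    using op by (rule openin_Int[rotated])
  then have "openin (top_of_set X) (fst ` (Sigma X g \<inter> (Sigma X f \<inter> UNIV \<times> V')))"
    by (rule covering_space_open_map[OF covering_space_fst_Sigma[OF f]])
  moreover have "Sigma X g \<inter> (Sigma X f \<inter> UNIV \<times> V') = (SIGMA x:X. g x \<inter> V)"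
    using card gY V'(2) by auto
  ultimately show "openin (top_of_set X) {x \<in> topspace (top_of_set X). g x \<inter> V \<noteq> {}}"
    by (simp add: fst_image_Sigma)
qed fact

lemma nvalued_map_path_component_closed:
  fixes X :: "'a::real_normed_vector set" and Y :: "'b::real_normed_vector set"
  assumes f: "nvalued_map n (top_of_set X) (top_of_set Y) f"
    and X: "locally path_connected X"
    and closed: "\<And>p q. p \<in> Sigma X g \<Longrightarrow> path_component (Sigma X f) p q \<Longrightarrow> q \<in> Sigma X g"
    and card: "\<And>x. x \<in> X \<Longrightarrow> g x \<subseteq> f x \<and> card (g x) = m" and "0 < m"
  shows "nvalued_map m (top_of_set X) (top_of_set Y) g"
proof (rule nvalued_map_of_openin_Sigma[OF f])
  have lpc: "locally path_connected (Sigma X f)"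
    using covering_space_locally_path_connected_eq[OF covering_space_fst_Sigma[OF f]] X by blast
  have "Sigma X g = (\<Union>p\<in>Sigma X g. path_component_set (Sigma X f) p)"
  proof (intro equalityI subsetI)
    fix p assume p: "p \<in> Sigma X g"
    then have "path_component (Sigma X f) p p" using card by (auto intro!: path_component_refl)
    with p show "p \<in> (\<Union>p\<in>Sigma X g. path_component_set (Sigma X f) p)" by blast
  qed (use closed in blast)
  moreover have "openin (top_of_set (Sigma X f)) (\<Union>p\<in>Sigma X g. path_component_set (Sigma X f) p)"
    by (rule openin_Union) (use lpc openin_path_component_locally_path_connected in blast)
  ultimately show "openin (top_of_set (Sigma X f)) (Sigma X g)" by simp
qed (use card \<open>0 < m\<close> in auto)

text \<open>Here \<open>r\<close> picks a base point in each path component of \<open>X\<close> and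
  \<open>A\<close> a set of values above it; \<open>inv\<close> says that monodromy preserves this
  set. The first map takes at \<open>x\<close> the values reachable in the graph from
  \<open>A (r x)\<close>, the second one the remaining values.\<close>

lemma proper_partition_of_invariant_sets:
  fixes X :: "'a::real_normed_vector set" and Y :: "'b::real_normed_vector set"
  assumes f: "nvalued_map n (top_of_set X) (top_of_set Y) f"
    and X: "locally path_connected X"
    and r: "\<And>x. x \<in> X \<Longrightarrow> path_component X (r x) x"
      "\<And>x x'. path_component X x x' \<Longrightarrow> r x = r x'"
    and A: "\<And>x. x \<in> X \<Longrightarrow> A (r x) \<subseteq> f (r x)" "\<And>x. x \<in> X \<Longrightarrow> card (A (r x)) = m"
    and inv: "\<And>x a b. x \<in> X \<Longrightarrow> a \<in> A (r x) \<Longrightarrow>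
      path_component (Sigma X f) (r x, a) (r x, b) \<Longrightarrow> b \<in> A (r x)"
    and ml: "0 < m" "0 < l" "m + l = n"
  shows "has_proper_partition n (top_of_set X) (top_of_set Y) f"
proof -
  define g where "g x = {y \<in> f x. \<exists>a\<in>A (r x). path_component (Sigma X f) (r x, a) (x, y)}" for x
  have card_g: "card (g x) = m" if x: "x \<in> X" for x
  proof -
    obtain \<theta> where \<theta>: "bij_betw \<theta> (f (r x)) (f x)"
      "\<And>y. y \<in> f (r x) \<Longrightarrow> path_component (Sigma X f) (r x, y) (x, \<theta> y)"
      using path_transport[OF f r(1)[OF x]] by blast
    \<comment> \<open>A value \<open>y\<close> reached from \<open>a\<close> is also the transport
      of some \<open>b\<close> in the fibre over \<open>r x\<close>. Going along one path and back
      along the other joins \<open>(r x, a)\<close> to \<open>(r x, b)\<close>, and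
      \<open>inv\<close> puts \<open>b\<close> into \<open>A (r x)\<close>.\<close>
    have "g x = \<theta> ` A (r x)"
    proof (intro equalityI subsetI)
      fix y assume "y \<in> g x"
      then obtain a where y: "y \<in> f x" "a \<in> A (r x)" "path_component (Sigma X f) (r x, a) (x, y)"
        unfolding g_def by blast
      then obtain b where b: "b \<in> f (r x)" "y = \<theta> b" using \<theta>(1) unfolding bij_betw_def by blast
      have "path_component (Sigma X f) (r x, a) (r x, b)"
        using y(3) \<theta>(2)[OF b(1)] b(2) path_component_sym path_component_trans by metis
      then show "y \<in> \<theta> ` A (r x)" using inv[OF x y(2)] b(2) by blast
    qed (use \<theta> A(1)[OF x] in \<open>auto simp: g_def bij_betw_def\<close>)
    moreover have "inj_on \<theta> (A (r x))"
      using \<theta>(1) A(1)[OF x] unfolding bij_betw_def by (blast intro: inj_on_subset)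
    ultimately show ?thesis using A(2)[OF x] by (simp add: card_image)
  qed
  have closed: "q \<in> Sigma X g" if p: "p \<in> Sigma X g" "path_component (Sigma X f) p q" for p q
  proof -
    obtain x y where xy: "p = (x, y)" "x \<in> X" "y \<in> g x" using p(1) by blast
    obtain x' y' where q: "q = (x', y')" "x' \<in> X" "y' \<in> f x'"
      using path_component_mem(2)[OF p(2)] by blast
    obtain a where a: "a \<in> A (r x)" "path_component (Sigma X f) (r x, a) (x, y)"
      using xy(3) unfolding g_def by blast
    have "r x = r x'" using r(2) path_component_fst_Sigma[OF p(2)] xy q by simp
    moreover have "path_component (Sigma X f) (r x, a) (x', y')"
      using a(2) p(2) xy(1) q(1) path_component_trans by metis
    ultimately show ?thesis using a(1) q unfolding g_def by auto
  qed
  have g: "nvalued_map m (top_of_set X) (top_of_set Y) g"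
    by (rule nvalued_map_path_component_closed[OF f X]) (use closed card_g ml in \<open>auto simp: g_def\<close>)
  have h: "nvalued_map l (top_of_set X) (top_of_set Y) (\<lambda>x. f x - g x)"
  proof (rule nvalued_map_path_component_closed[OF f X])
    \<comment> \<open>A path leaving the complement of \<open>Sigma X g\<close> would, reversed, be
      a path leaving \<open>Sigma X g\<close>.\<close>
    fix p q assume p: "p \<in> (SIGMA x:X. f x - g x)" "path_component (Sigma X f) p q"
    then have "q \<in> Sigma X f" "q \<notin> Sigma X g"
      using path_component_mem(2) closed[OF _ path_component_sym[OF p(2)]] by fast+
    then show "q \<in> (SIGMA x:X. f x - g x)" by blast
  next
    fix x assume x: "x \<in> X"
    have gf: "g x \<subseteq> f x" by (auto simp: g_def)
    then have "card (f x - g x) = card (f x) - card (g x)"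
      using nvalued_mapD(2)[OF f, of x] x by (intro card_Diff_subset) (auto intro: finite_subset)
    then show "f x - g x \<subseteq> f x \<and> card (f x - g x) = l"
      using nvalued_mapD(3)[OF f, of x] card_g[OF x] x ml by auto
  qed fact
  have "nvalued_partition n (top_of_set X) (top_of_set Y) f 2 (\<lambda>i. if i = 0 then m else l)
      (\<lambda>i. if i = 0 then g else (\<lambda>x. f x - g x))"
    unfolding nvalued_partition_def using g h ml
    by (auto simp: numeral_2_eq_2 lessThan_Suc g_def)
  then show ?thesis unfolding has_proper_partition_def by blast
qed

section \<open>Fundamental groups\<close>

abbreviation loop_homotopic :: "'a topology \<Rightarrow> 'a \<Rightarrow> (real \<Rightarrow> 'a) \<Rightarrow> (real \<Rightarrow> 'a) \<Rightarrow> bool" where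
  "loop_homotopic X x0 \<equiv> homotopic_with (\<lambda>r. r 0 = x0 \<and> r 1 = x0) (top_of_set {0..1}) X"

lemma loop_homotopic_imp_loops:
  assumes "loop_homotopic X x0 p q"
  shows "p \<in> loops_at X x0" "q \<in> loops_at X x0"
  using homotopic_with_imp_continuous_maps[OF assms] homotopic_with_imp_property[OF assms]
  by (auto simp: loops_at_def pathin_def)

text \<open>Loops are total functions on the reals, so identities valid only on the unit interval
  enter as homotopies.\<close>

lemma loop_homotopic_equal:
  assumes "p \<in> loops_at X x0" and "\<And>t. t \<in> {0..1} \<Longrightarrow> p t = q t"
  shows "loop_homotopic X x0 p q"
  by (rule homotopic_with_equal) (use assms in \<open>auto simp: loops_at_def pathin_def\<close>)

lemma loop_class_self: "p \<in> loops_at X x0 \<Longrightarrow> p \<in> loop_class X x0 p"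
  unfolding loop_class_def using loop_homotopic_equal[OF _ refl] by (rule CollectI)

lemma loop_class_eqI:
  assumes "loop_homotopic X x0 p q"
  shows "loop_class X x0 p = loop_class X x0 q"
  unfolding loop_class_def
proof (intro Collect_cong iffI)
  fix r
  show "loop_homotopic X x0 q r" if "loop_homotopic X x0 p r"
    by (rule homotopic_with_trans[OF homotopic_with_symD[OF assms] that])
  show "loop_homotopic X x0 p r" if "loop_homotopic X x0 q r"
    by (rule homotopic_with_trans[OF assms that])
qed

lemma loop_class_eqD:
  assumes "loop_class X x0 p = loop_class X x0 q" "q \<in> loops_at X x0"
  shows "loop_homotopic X x0 p q"
proof -
  have "q \<in> loop_class X x0 p"
    unfolding assms(1) by (rule loop_class_self[OF assms(2)])
  then show ?thesis
    unfolding loop_class_def by (rule CollectD)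
qed

section \<open>Group laws for loops\<close>

text \<open>The straight-line homotopy from \<phi> to \<psi> stays in the unit interval and fixes
  the ends, so \<open>p\<close> carries it to \<open>X\<close>. Associativity, unit and inverse are
  all instances.\<close>

lemma loop_homotopic_reparametrize:
  fixes \<phi> \<psi> :: "real \<Rightarrow> real"
  assumes p: "pathin X p"
    and \<phi>: "continuous_on {0..1} \<phi>" "\<And>t. t \<in> {0..1} \<Longrightarrow> \<phi> t \<in> {0..1}"
    and \<psi>: "continuous_on {0..1} \<psi>" "\<And>t. t \<in> {0..1} \<Longrightarrow> \<psi> t \<in> {0..1}"
    and ends: "\<phi> 0 = \<psi> 0" "\<phi> 1 = \<psi> 1" "q 0 = x0" "q 1 = x0"
    and q: "\<And>t. t \<in> {0..1} \<Longrightarrow> q t = p (\<phi> t)" and r: "\<And>t. t \<in> {0..1} \<Longrightarrow> r t = p (\<psi> t)"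
  shows "loop_homotopic X x0 q r"
proof -
  have "homotopic_paths {0..1} \<phi> \<psi>"
  proof (rule homotopic_paths_linear)
    show "closed_segment (\<phi> t) (\<psi> t) \<subseteq> {0..1}" if "t \<in> {0..1}" for t
      using \<phi>(2)[OF that] \<psi>(2)[OF that] by (simp add: closed_segment_subset)
  qed (use \<phi> \<psi> ends in \<open>auto simp: path_def pathstart_def pathfinish_def\<close>)
  then have "homotopic_with (\<lambda>r. pathstart r = \<phi> 0 \<and> pathfinish r = \<phi> 1)
      (top_of_set {0..1}) (top_of_set {0..1}) \<phi> \<psi>"
    by (simp add: homotopic_paths_def pathstart_def pathfinish_def)
  then have hom: "loop_homotopic X x0 (p \<circ> \<phi>) (p \<circ> \<psi>)"
    by (rule homotopic_with_compose_continuous_map_left)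
      (use p ends q[of 0] q[of 1] in \<open>auto simp: pathin_def pathstart_def pathfinish_def\<close>)
  note loops = loop_homotopic_imp_loops[OF hom]
  have "loop_homotopic X x0 q (p \<circ> \<phi>)"
    by (rule homotopic_with_symD[OF loop_homotopic_equal[OF loops(1)]]) (simp add: q)
  moreover have "loop_homotopic X x0 (p \<circ> \<psi>) r"
    by (rule loop_homotopic_equal[OF loops(2)]) (simp add: r)
  ultimately show ?thesis
    by (rule homotopic_with_trans[OF homotopic_with_trans[OF _ hom]])
qed

lemma loop_homotopic_join:
  assumes "loop_homotopic X x0 p p'" "loop_homotopic X x0 q q'"
  shows "loop_homotopic X x0 (join_loops p q) (join_loops p' q')"
proof -
  let ?I = "{0..1::real}"
  obtain h where h: "continuous_map (top_of_set (?I \<times> ?I)) X h"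
    "\<And>s. h (0, s) = p s" "\<And>s. h (1, s) = p' s"
    "\<And>t. t \<in> ?I \<Longrightarrow> h (t, 0) = x0" "\<And>t. t \<in> ?I \<Longrightarrow> h (t, 1) = x0"
    using assms(1) unfolding homotopic_with_def by auto
  obtain k where k: "continuous_map (top_of_set (?I \<times> ?I)) X k"
    "\<And>s. k (0, s) = q s" "\<And>s. k (1, s) = q' s"
    "\<And>t. t \<in> ?I \<Longrightarrow> k (t, 0) = x0" "\<And>t. t \<in> ?I \<Longrightarrow> k (t, 1) = x0"
    using assms(2) unfolding homotopic_with_def by auto
  \<comment> \<open>The first coordinate is the homotopy parameter, the second the time. The halves
    fit together at time \<open>1/2\<close>, where both homotopies stay at
    \<open>x0\<close>.\<close>
  define H where "H y = (if snd y \<le> 1/2 then (h \<circ> (\<lambda>y. (fst y, 2 * snd y))) y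
    else (k \<circ> (\<lambda>y. (fst y, 2 * snd y - 1))) y)" for y :: "real \<times> real"
  have "continuous_map (top_of_set (?I \<times> ?I)) X H"
    unfolding H_def
  proof (rule continuous_map_cases_le)
    show "continuous_map (subtopology (top_of_set (?I \<times> ?I)) {y \<in> topspace (top_of_set (?I \<times> ?I)). snd y \<le> 1/2}) X
        (h \<circ> (\<lambda>y. (fst y, 2 * snd y)))"
      unfolding subtopology_subtopology
      by (rule continuous_map_compose[OF _ h(1)])
        (auto simp: continuous_map_in_subtopology intro!: continuous_intros)
    show "continuous_map (subtopology (top_of_set (?I \<times> ?I)) {y \<in> topspace (top_of_set (?I \<times> ?I)). 1/2 \<le> snd y}) X
        (k \<circ> (\<lambda>y. (fst y, 2 * snd y - 1)))"
      unfolding subtopology_subtopology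
      by (rule continuous_map_compose[OF _ k(1)])
        (auto simp: continuous_map_in_subtopology intro!: continuous_intros)
    show "(h \<circ> (\<lambda>y. (fst y, 2 * snd y))) y = (k \<circ> (\<lambda>y. (fst y, 2 * snd y - 1))) y"
      if "y \<in> topspace (top_of_set (?I \<times> ?I))" "snd y = 1/2" for y
    proof -
      have y: "2 * snd y = 1" "fst y \<in> ?I" using that by auto
      show ?thesis by (simp add: y(1) h(5)[OF y(2)] k(4)[OF y(2)])
    qed
  qed (auto intro!: continuous_intros)
  then show ?thesis
    unfolding homotopic_with_def
  proof (intro exI[of _ H] conjI allI ballI)
    show "H (0, s) = join_loops p q s" "H (1, s) = join_loops p' q' s" for s
      by (simp_all add: H_def join_loops_def h(2,3) k(2,3))
    show "H (t, 0) = x0" "H (t, 1) = x0" if "t \<in> ?I" for t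
      using h(4)[OF that] k(5)[OF that] by (simp_all add: H_def)
  qed simp
qed

lemma loops_at_join:
  "p \<in> loops_at X x0 \<Longrightarrow> q \<in> loops_at X x0 \<Longrightarrow> join_loops p q \<in> loops_at X x0"
  by (rule loop_homotopic_imp_loops(1)[OF loop_homotopic_join[OF loop_homotopic_equal[OF _ refl]
    loop_homotopic_equal[OF _ refl]]])

lemma loops_at_const: "x0 \<in> topspace X \<Longrightarrow> (\<lambda>_. x0) \<in> loops_at X x0"
  by (simp add: loops_at_def pathin_const)

lemma loops_at_reverse:
  assumes "p \<in> loops_at X x0"
  shows "(\<lambda>t. p (1 - t)) \<in> loops_at X x0"
proof -
  have "continuous_map (top_of_set {0..1}) (top_of_set {0..1::real}) (\<lambda>t. 1 - t)"
    by (auto simp: continuous_map_in_subtopology intro!: continuous_intros)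
  then have "continuous_map (top_of_set {0..1}) X (p \<circ> (\<lambda>t. 1 - t))"
    by (rule continuous_map_compose) (use assms in \<open>simp add: loops_at_def pathin_def\<close>)
  then show ?thesis using assms by (simp add: loops_at_def pathin_def o_def)
qed

lemma loops_at_compose:
  "p \<in> loops_at X x0 \<Longrightarrow> continuous_map X Y f \<Longrightarrow> f \<circ> p \<in> loops_at Y (f x0)"
  by (auto simp: loops_at_def intro: pathin_compose)

text \<open>The union defining the product runs over classes that all coincide, and it is not over
  an empty family because \<open>p\<close> and \<open>q\<close> belong to their own classes.\<close>

lemma loop_class_mult:
  assumes "p \<in> loops_at X x0" "q \<in> loops_at X x0"
  shows "loop_class X x0 p \<otimes>\<^bsub>fundamental_group X x0\<^esub> loop_class X x0 q =
    loop_class X x0 (join_loops p q)"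
proof -
  let ?c = "loop_class X x0"
  have eq: "?c (join_loops p' q') = ?c (join_loops p q)" if "p' \<in> ?c p" "q' \<in> ?c q" for p' q'
  proof -
    have "loop_homotopic X x0 p p'" "loop_homotopic X x0 q q'"
      using that by (simp_all only: loop_class_def mem_Collect_eq)
    then show ?thesis by (rule loop_class_eqI[OF loop_homotopic_join, symmetric])
  qed
  have "?c p \<otimes>\<^bsub>fundamental_group X x0\<^esub> ?c q = (\<Union>p'\<in>?c p. \<Union>q'\<in>?c q. ?c (join_loops p' q'))"
    by (simp add: fundamental_group_def)
  also have "\<dots> = (\<Union>p'\<in>?c p. \<Union>q'\<in>?c q. ?c (join_loops p q))"
    by (intro SUP_cong refl eq)
  also have "\<dots> = ?c (join_loops p q)"
    using loop_class_self[OF assms(1)] loop_class_self[OF assms(2)] by blast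
  finally show ?thesis .
qed

lemma join_loops_assoc:
  assumes "p \<in> loops_at X x0" "q \<in> loops_at X x0" "r \<in> loops_at X x0"
  shows "loop_homotopic X x0 (join_loops (join_loops p q) r) (join_loops p (join_loops q r))"
proof (rule loop_homotopic_reparametrize)
  show "pathin X (join_loops p (join_loops q r))"
    using loops_at_join[OF assms(1) loops_at_join[OF assms(2,3)]] by (simp add: loops_at_def)
  \<comment> \<open>The piecewise linear map taking the breakpoints \<open>1/4\<close>,
    \<open>1/2\<close> to \<open>1/2\<close>, \<open>3/4\<close>. Its slopes \<open>2\<close>,
    \<open>1\<close>, \<open>1/2\<close> decrease, so it is the minimum of its three linear
    pieces.\<close>
  let ?\<phi> = "\<lambda>t::real. min (2 * t) (min (t + 1/4) ((t + 1) / 2))"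
  show "continuous_on {0..1} ?\<phi>" by (intro continuous_intros) auto
  show "?\<phi> t \<in> {0..1}" if "t \<in> {0..1}" for t
    using that by (auto simp: min_def)
  show "join_loops (join_loops p q) r t = join_loops p (join_loops q r) (?\<phi> t)" if "t \<in> {0..1}" for t
  proof -
    consider "t \<le> 1/4" | "1/4 < t" "t \<le> 1/2" | "1/2 < t" by linarith
    then show ?thesis
    proof cases
      case 1
      then have "?\<phi> t = 2 * t" by (simp add: min_def)
      with 1 show ?thesis by (simp add: join_loops_def)
    next
      case 2
      then have "?\<phi> t = t + 1/4" by (simp add: min_def)
      with 2 show ?thesis by (simp add: join_loops_def algebra_simps)
    next
      case 3
      then have "?\<phi> t = (t + 1) / 2" by (simp add: min_def)
      moreover have "2 * (2 * ((t + 1) / 2) - 1) - 1 = 2 * t - 1" by (simp add: field_simps)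
      then have "r (2 * (2 * ((t + 1) / 2) - 1) - 1) = r (2 * t - 1)" by (rule arg_cong)
      ultimately show ?thesis using 3 unfolding join_loops_def by simp
    qed
  qed
qed (use assms in \<open>auto simp: join_loops_def loops_at_def\<close>)

lemma join_loops_const_left:
  assumes "p \<in> loops_at X x0"
  shows "loop_homotopic X x0 (join_loops (\<lambda>_. x0) p) p"
proof (rule loop_homotopic_reparametrize)
  show "pathin X p" using assms by (simp add: loops_at_def)
  \<comment> \<open>The parameter waits at \<open>0\<close> during the first half, while the
    constant loop runs.\<close>
  show "continuous_on {0..1} (\<lambda>t::real. max 0 (2 * t - 1))" by (intro continuous_intros)
  show "join_loops (\<lambda>_. x0) p t = p (max 0 (2 * t - 1))" for t
  proof (cases "t \<le> 1/2")
    case True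
    then have "max 0 (2 * t - 1) = 0" by simp
    with True show ?thesis using assms by (simp add: join_loops_def loops_at_def)
  next
    case False
    then have "max 0 (2 * t - 1) = 2 * t - 1" by simp
    with False show ?thesis by (simp add: join_loops_def)
  qed
qed (use assms in \<open>auto simp: join_loops_def loops_at_def\<close>)

lemma join_loops_reverse:
  assumes "p \<in> loops_at X x0"
  shows "loop_homotopic X x0 (join_loops (\<lambda>t. p (1 - t)) p) (\<lambda>_. x0)"
proof (rule loop_homotopic_reparametrize)
  show "pathin X p" using assms by (simp add: loops_at_def)
  \<comment> \<open>The parameter runs from \<open>1\<close> down to \<open>0\<close> and back; it
    is contracted to the constant \<open>1\<close>, where \<open>p\<close> has the value
    \<open>x0\<close>.\<close>
  show "continuous_on {0..1} (\<lambda>t::real. \<bar>2 * t - 1\<bar>)" by (intro continuous_intros)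
  show "continuous_on {0..1} (\<lambda>t::real. 1::real)" by simp
  show "join_loops (\<lambda>t. p (1 - t)) p t = p \<bar>2 * t - 1\<bar>" for t
  proof (cases "t \<le> 1/2")
    case True
    then have "\<bar>2 * t - 1\<bar> = 1 - 2 * t" by (simp add: abs_if)
    with True show ?thesis by (simp add: join_loops_def)
  next
    case False
    then have "\<bar>2 * t - 1\<bar> = 2 * t - 1" by (simp add: abs_if)
    with False show ?thesis by (simp add: join_loops_def)
  qed
qed (use assms in \<open>auto simp: join_loops_def loops_at_def abs_if\<close>)

lemma group_fundamental_group:
  assumes x0: "x0 \<in> topspace X"
  shows "group (fundamental_group X x0)"
proof -
  let ?G = "fundamental_group X x0" and ?c = "loop_class X x0"
  have carrier: "carrier ?G = ?c ` loops_at X x0" and one: "\<one>\<^bsub>?G\<^esub> = ?c (\<lambda>_. x0)"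
    by (simp_all add: fundamental_group_def)
  note mult = loop_class_mult
  show ?thesis
  \<comment> \<open>\<open>groupI\<close> asks only for a left unit and left inverses, hence the
    one-sided lemmas above.\<close>
  proof (rule groupI)
    fix a b assume "a \<in> carrier ?G" "b \<in> carrier ?G"
    then show "a \<otimes>\<^bsub>?G\<^esub> b \<in> carrier ?G"
      unfolding carrier by (auto simp: mult loops_at_join)
  next
    show "\<one>\<^bsub>?G\<^esub> \<in> carrier ?G"
      unfolding carrier one using loops_at_const[OF x0] by blast
  next
    fix a b c assume "a \<in> carrier ?G" "b \<in> carrier ?G" "c \<in> carrier ?G"
    then obtain p q r where "p \<in> loops_at X x0" "q \<in> loops_at X x0" "r \<in> loops_at X x0"
      "a = ?c p" "b = ?c q" "c = ?c r" unfolding carrier by blast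
    then show "a \<otimes>\<^bsub>?G\<^esub> b \<otimes>\<^bsub>?G\<^esub> c = a \<otimes>\<^bsub>?G\<^esub> (b \<otimes>\<^bsub>?G\<^esub> c)"
      by (simp add: mult loops_at_join loop_class_eqI[OF join_loops_assoc])
  next
    fix a assume "a \<in> carrier ?G"
    then obtain p where p: "p \<in> loops_at X x0" "a = ?c p" unfolding carrier by blast
    then show "\<one>\<^bsub>?G\<^esub> \<otimes>\<^bsub>?G\<^esub> a = a"
      by (simp add: one mult loops_at_const[OF x0] loop_class_eqI[OF join_loops_const_left])
    have "?c (\<lambda>t. p (1 - t)) \<otimes>\<^bsub>?G\<^esub> a = \<one>\<^bsub>?G\<^esub>"
      using p by (simp add: one mult loops_at_reverse loop_class_eqI[OF join_loops_reverse])
    then show "\<exists>y\<in>carrier ?G. y \<otimes>\<^bsub>?G\<^esub> a = \<one>\<^bsub>?G\<^esub>"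
      using loops_at_reverse[OF p(1)] unfolding carrier by blast
  qed
qed

lemma induced_hom_loop_class:
  assumes "continuous_map X Y f" "p \<in> loops_at X x0"
  shows "induced_hom Y f x0 (loop_class X x0 p) = loop_class Y (f x0) (f \<circ> p)"
proof -
  have "loop_class Y (f x0) (f \<circ> q) = loop_class Y (f x0) (f \<circ> p)" if "q \<in> loop_class X x0 p" for q
  proof -
    have "loop_homotopic X x0 p q" using that by (simp add: loop_class_def)
    then have "loop_homotopic Y (f x0) (f \<circ> p) (f \<circ> q)"
      by (rule homotopic_with_compose_continuous_map_left[OF _ assms(1)]) simp
    then show ?thesis by (rule loop_class_eqI[symmetric])
  qed
  then show ?thesis
    using loop_class_self[OF assms(2)] unfolding induced_hom_def by blast
qed

lemma induced_image_eq:
  assumes "continuous_map X Y f"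
  shows "induced_image X Y f x0 = (\<lambda>p. loop_class Y (f x0) (f \<circ> p)) ` loops_at X x0"
  using induced_hom_loop_class[OF assms]
  by (simp add: induced_image_def fundamental_group_def image_image)

text \<open>Used for \<open>f\<close> and for \<open>forget_conf\<close>, so that both images are
  subgroups of one braid group and only their inclusion is left to compare.\<close>

lemma subgroup_induced_image:
  assumes f: "continuous_map X Y f" and x0: "x0 \<in> topspace X"
  shows "subgroup (induced_image X Y f x0) (fundamental_group Y (f x0))"
proof -
  let ?G = "fundamental_group X x0" and ?H = "fundamental_group Y (f x0)"
  have join: "f \<circ> join_loops p q = join_loops (f \<circ> p) (f \<circ> q)" for p q
    by (auto simp: join_loops_def)
  have "induced_hom Y f x0 \<in> hom ?G ?H"
  proof (rule homI)
    fix a assume "a \<in> carrier ?G"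
    then show "induced_hom Y f x0 a \<in> carrier ?H"
      using loops_at_compose[OF _ f]
      by (auto simp: fundamental_group_def induced_hom_loop_class[OF f])
  next
    fix a b assume "a \<in> carrier ?G" "b \<in> carrier ?G"
    then obtain p q where "p \<in> loops_at X x0" "q \<in> loops_at X x0"
      "a = loop_class X x0 p" "b = loop_class X x0 q" by (auto simp: fundamental_group_def)
    then show "induced_hom Y f x0 (a \<otimes>\<^bsub>?G\<^esub> b) = induced_hom Y f x0 a \<otimes>\<^bsub>?H\<^esub> induced_hom Y f x0 b"
      using f by (simp add: loop_class_mult induced_hom_loop_class loops_at_join loops_at_compose join)
  qed
  moreover have "f x0 \<in> topspace Y" using f x0 by (auto simp: continuous_map_def)
  then have "group ?H" by (rule group_fundamental_group)
  ultimately have "group_hom ?G ?H (induced_hom Y f x0)"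
    using group_fundamental_group[OF x0] by (simp add: group_hom_def group_hom_axioms_def)
  then show ?thesis
    unfolding induced_image_def by (rule group_hom.img_is_subgroup)
qed

section \<open>Partitions and mixed braid groups\<close>

text \<open>A homotopy from \<open>f \<circ> p\<close> to a loop of mixed configurations is an \<open>n\<close>-valued map on the unit
  square, so the lift of \<open>p\<close> starting at \<open>a\<close> extends to a section over the square. This section is
  constant on the two sides where the homotopy is constant, and on the remaining side it is a strand
  of the mixed loop.\<close>

lemma mixed_braid_monodromy:
  fixes X :: "'a::real_normed_vector set" and Y :: "'b::real_normed_vector set"
  assumes f: "nvalued_map (m + l) (top_of_set X) (top_of_set Y) f" and m: "0 < m"
    and c: "c \<in> topspace (mixed_conf m l (top_of_set Y))" "forget_conf c = f x0"
    and sub: "induced_image (top_of_set X) (unordered_conf (m + l) (top_of_set Y)) f x0 \<subseteq>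
      induced_image (mixed_conf m l (top_of_set Y)) (unordered_conf (m + l) (top_of_set Y)) forget_conf c"
    and a: "a \<in> fst c" and ab: "path_component (Sigma X f) (x0, a) (x0, b)"
  shows "b \<in> fst c"
proof -
  let ?I = "{0..1::real}" and ?Y = "top_of_set Y"
  let ?D = "unordered_conf (m + l) ?Y"
  obtain g where g: "path g" "path_image g \<subseteq> Sigma X f" "g 0 = (x0, a)" "g 1 = (x0, b)"
    using ab unfolding path_component_def pathstart_def pathfinish_def by blast
  define p where "p = fst \<circ> g"
  define \<sigma> where "\<sigma> = snd \<circ> g"
  have cont: "continuous_on ?I p" "continuous_on ?I \<sigma>"
    using g(1) unfolding p_def \<sigma>_def path_def o_def by (auto intro: continuous_intros)
  have g': "p t \<in> X" "\<sigma> t \<in> f (p t)" if "t \<in> ?I" for t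
  proof -
    have "g t \<in> Sigma X f" using g(2) that unfolding path_image_def by blast
    then show "p t \<in> X" "\<sigma> t \<in> f (p t)" unfolding p_def \<sigma>_def by auto
  qed
  have ends: "p 0 = x0" "p 1 = x0" "\<sigma> 0 = a" "\<sigma> 1 = b"
    using g(3,4) by (simp_all add: p_def \<sigma>_def)
  have p: "p \<in> loops_at (top_of_set X) x0"
    using cont(1) g'(1) ends unfolding loops_at_def pathin_def by (auto simp: continuous_map_in_subtopology)
  have cf: "continuous_map (top_of_set X) ?D f"
    using f by (simp add: nvalued_map_def)
  have "loop_class ?D (f x0) (f \<circ> p) \<in>
      induced_image (mixed_conf m l ?Y) ?D forget_conf c"
    using sub p unfolding induced_image_eq[OF cf] by blast
  then obtain q where q: "q \<in> loops_at (mixed_conf m l ?Y) c"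
      "loop_class ?D (f x0) (f \<circ> p) = loop_class ?D (f x0) (forget_conf \<circ> q)"
    unfolding induced_image_eq[OF continuous_map_forget_conf] c(2) by blast
  have "forget_conf \<circ> q \<in> loops_at ?D (f x0)"
    using loops_at_compose[OF q(1) continuous_map_forget_conf] c(2) by simp
  then have "loop_homotopic ?D (f x0) (f \<circ> p) (forget_conf \<circ> q)"
    by (rule loop_class_eqD[OF q(2)])
  then obtain h where h: "continuous_map (top_of_set (?I \<times> ?I)) ?D h"
    "\<And>t. h (0, t) = f (p t)" "\<And>t. h (1, t) = forget_conf (q t)"
    "\<And>s. s \<in> ?I \<Longrightarrow> h (s, 0) = f x0" "\<And>s. s \<in> ?I \<Longrightarrow> h (s, 1) = f x0"
    unfolding homotopic_with_def by auto
  have H: "nvalued_map (m + l) (top_of_set (?I \<times> ?I)) ?Y h"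
    using h(1) m by (simp add: nvalued_map_def)
  have conv: "convex (?I \<times> ?I)" "convex ?I" by (auto intro: convex_Times)
  have a0: "a \<in> h (0, 0)" using a c(2) by (auto simp: h(2) ends forget_conf_def)
  have zero: "(0, 0) \<in> ?I \<times> ?I" by simp
  obtain \<Sigma> where \<Sigma>: "continuous_on (?I \<times> ?I) \<Sigma>" "\<And>z. z \<in> ?I \<times> ?I \<Longrightarrow> \<Sigma> z \<in> h z" "\<Sigma> (0, 0) = a"
    using section_exists[OF H convex_imp_simply_connected[OF conv(1)]
      convex_imp_locally_path_connected[OF conv(1)] zero a0] by blast
  have left: "nvalued_map (m + l) (top_of_set ?I) ?Y (\<lambda>t. h (s, t))"
    and bottom: "nvalued_map (m + l) (top_of_set ?I) ?Y (\<lambda>t. h (t, s))"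
    and cleft: "continuous_on ?I (\<lambda>t. \<Sigma> (s, t))" and cbottom: "continuous_on ?I (\<lambda>t. \<Sigma> (t, s))"
    if s: "s \<in> ?I" for s
  proof -
    have "continuous_map (top_of_set ?I) (top_of_set (?I \<times> ?I)) (\<lambda>t. (s, t))"
      "continuous_map (top_of_set ?I) (top_of_set (?I \<times> ?I)) (\<lambda>t. (t, s))"
      using s by (auto simp: continuous_map_in_subtopology intro!: continuous_intros)
    then show "nvalued_map (m + l) (top_of_set ?I) ?Y (\<lambda>t. h (s, t))"
      "nvalued_map (m + l) (top_of_set ?I) ?Y (\<lambda>t. h (t, s))"
      using nvalued_map_compose[OF H, of _ "\<lambda>t. (s, t)"] nvalued_map_compose[OF H, of _ "\<lambda>t. (t, s)"]
      by simp_all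
    show "continuous_on ?I (\<lambda>t. \<Sigma> (s, t))" "continuous_on ?I (\<lambda>t. \<Sigma> (t, s))"
      using s by (auto intro!: continuous_on_compose2[OF \<Sigma>(1)] continuous_intros)
  qed
  have I01: "0 \<in> ?I" "1 \<in> ?I" by simp_all
  have conn: "connected ?I" by simp
  have "\<Sigma> (0, 1) = \<sigma> 1"
    by (rule section_unique[OF left[OF I01(1)] conn cleft[OF I01(1)] \<Sigma>(2) cont(2) _ I01(1) _ I01(2)])
      (use g'(2) ends \<Sigma>(3) in \<open>auto simp: h(2)\<close>)
  then have b0: "\<Sigma> (0, 1) = b" using ends by simp
  have a1: "\<Sigma> (1, 0) = a"
    by (rule section_unique[OF bottom[OF I01(1)] conn cbottom[OF I01(1)] \<Sigma>(2) continuous_on_const _ I01(1) _ I01(2)])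
      (use a0 \<Sigma>(3) ends in \<open>auto simp: h(2,4)\<close>)
  have "b \<in> f x0" using g'(2)[OF I01(2)] ends by simp
  then have b1: "\<Sigma> (1, 1) = b"
    by (intro section_unique[OF bottom[OF I01(2)] conn cbottom[OF I01(2)] \<Sigma>(2) continuous_on_const _ I01(1) _ I01(2)])
      (use b0 in \<open>auto simp: h(5)\<close>)
  have "continuous_map (top_of_set ?I) (unordered_conf m ?Y) (fst \<circ> q)"
    using q(1) continuous_map_compose[OF _ continuous_map_mixed_conf_fst]
    unfolding loops_at_def pathin_def by blast
  \<comment> \<open>Lifting inside this \<open>m\<close>-valued map, instead of among all
    \<open>m + l\<close> strands, keeps the strand from \<open>a\<close> in
    \<open>fst (q t)\<close>; as \<open>q\<close> is a loop at \<open>c\<close>, the strand ends in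
    \<open>fst c\<close>.\<close>
  then have A: "nvalued_map m (top_of_set ?I) ?Y (\<lambda>t. fst (q t))"
    using m by (simp add: nvalued_map_def o_def)
  have q01: "q 0 = c" "q 1 = c" using q(1) by (auto simp: loops_at_def)
  have aq: "a \<in> fst (q 0)" using a q01 by simp
  obtain \<tau> where \<tau>: "continuous_on ?I \<tau>" "\<And>t. t \<in> ?I \<Longrightarrow> \<tau> t \<in> fst (q t)" "\<tau> 0 = a"
    using section_exists[OF A convex_imp_simply_connected[OF conv(2)]
      convex_imp_locally_path_connected[OF conv(2)] I01(1) aq] by blast
  have "\<Sigma> (1, 1) = \<tau> 1"
    by (rule section_unique[OF left[OF I01(2)] conn cleft[OF I01(2)] \<Sigma>(2) \<tau>(1) _ I01(1) _ I01(2)])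
      (use \<tau> a1 in \<open>auto simp: h(3) forget_conf_def\<close>)
  then show "b \<in> fst c" using b1 \<tau>(2)[OF I01(2)] q01 by simp
qed

section \<open>From a partition to a mixed braid group\<close>

text \<open>All maps except the first are merged into one. Counting does the rest: the merged map
  has at most \<open>l\<close> values, and together with the \<open>k 0\<close> values of the first
  it must produce \<open>k 0 + l\<close> points, which forces both equality and
  disjointness.\<close>

lemma proper_partition_two:
  assumes Y: "Hausdorff_space Y" and f: "nvalued_map n X Y f" and part: "has_proper_partition n X Y f"
  obtains m l G H where "0 < m" "0 < l" "m + l = n" "nvalued_map m X Y G" "nvalued_map l X Y H"
    "\<And>x. x \<in> topspace X \<Longrightarrow> f x = G x \<union> H x" "\<And>x. x \<in> topspace X \<Longrightarrow> G x \<inter> H x = {}"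
proof -
  obtain s :: nat and k g where s: "2 \<le> s" and g: "\<And>i. i < s \<Longrightarrow> nvalued_map (k i) X Y (g i)"
    and sum: "(\<Sum>i<s. k i) = n" and Un: "\<And>x. x \<in> topspace X \<Longrightarrow> f x = (\<Union>i<s. g i x)"
    using part unfolding has_proper_partition_def nvalued_partition_def by blast
  define l where "l = (\<Sum>i\<in>{1..<s}. k i)"
  define H where "H x = (\<Union>i\<in>{1..<s}. g i x)" for x
  have ins: "{..<s} = insert 0 {1..<s}" using s by auto
  have ml: "k 0 + l = n" using sum unfolding ins l_def by simp
  have pos: "0 < k i" if "i < s" for i using g[OF that] by (simp add: nvalued_map_def)
  \<comment> \<open>Properness enters here: index \<open>1\<close> exists because
    \<open>2 \<le> s\<close>.\<close>
  have "k 1 \<le> l" unfolding l_def using s by (intro member_le_sum) auto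
  then have l: "0 < l" using pos[of 1] s by simp
  have fGH: "f x = g 0 x \<union> H x" if "x \<in> topspace X" for x
    using Un[OF that] unfolding ins H_def by simp
  have *: "H x \<subseteq> topspace Y \<and> finite (H x) \<and> card (H x) = l \<and> g 0 x \<inter> H x = {}" if x: "x \<in> topspace X" for x
  proof -
    have gi: "g i x \<subseteq> topspace Y" "finite (g i x)" "card (g i x) = k i" if "i < s" for i
      using nvalued_mapD[OF g[OF that] x] by auto
    have fin: "finite (H x)" "finite (g 0 x)" using gi s by (auto simp: H_def)
    have "card (H x) \<le> (\<Sum>i\<in>{1..<s}. card (g i x))"
      unfolding H_def by (rule card_UN_le) simp
    then have "card (H x) \<le> l" using gi(3) by (simp add: l_def)
    moreover have "card (g 0 x) + card (H x) = n + card (g 0 x \<inter> H x)"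
      using card_Un_Int[OF fin(2,1)] nvalued_mapD(3)[OF f x] fGH[OF x] by simp
    ultimately have "card (H x) = l" "card (g 0 x \<inter> H x) = 0"
      using gi(3)[of 0] ml s by auto
    moreover have "H x \<subseteq> topspace Y" using gi(1) by (force simp: H_def)
    ultimately show ?thesis using fin by simp
  qed
  have "nvalued_map l X Y H"
  proof (rule nvalued_mapI[OF Y l])
    fix V assume V: "openin Y V"
    have "{x \<in> topspace X. H x \<inter> V \<noteq> {}} = (\<Union>i\<in>{1..<s}. {x \<in> topspace X. g i x \<inter> V \<noteq> {}})"
      by (auto simp: H_def)
    also have "openin X \<dots>"
      by (rule openin_Union) (use nvalued_map_openin_meets[OF g Y V] in auto)
    finally show "openin X {x \<in> topspace X. H x \<inter> V \<noteq> {}}" .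
  qed (use * in blast)
  then show ?thesis
    using that[of "k 0" l "g 0" H] pos[of 0] l ml g[of 0] s fGH * by simp
qed

text \<open>On \<open>X\<close> the map \<open>f\<close> is \<open>forget_conf\<close> after the
  pair of \<open>G\<close> and \<open>H\<close>, so its action on loops factors through the mixed
  configuration space based at \<open>(G x0, H x0)\<close>.\<close>

lemma image_in_mixed_braids_of_partition:
  assumes Y: "Hausdorff_space Y" and x0: "x0 \<in> topspace X"
    and f: "nvalued_map (m + l) X Y f" and G: "nvalued_map m X Y G" and H: "nvalued_map l X Y H"
    and Un: "\<And>x. x \<in> topspace X \<Longrightarrow> f x = G x \<union> H x"
    and disj: "\<And>x. x \<in> topspace X \<Longrightarrow> G x \<inter> H x = {}"
  shows "image_in_mixed_braids m l X Y f x0"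
proof -
  let ?M = "mixed_conf m l Y" and ?D = "unordered_conf (m + l) Y"
  let ?P = "\<lambda>x. (G x, H x)"
  have cf: "continuous_map X ?D f" using f by (simp add: nvalued_map_def)
  have P: "continuous_map X ?M ?P"
    by (rule continuous_map_mixed_conf_Pair[OF Y]) (use G H disj in \<open>auto simp: nvalued_map_def\<close>)
  have c: "?P x0 \<in> topspace ?M" "forget_conf (?P x0) = f x0"
    using P x0 Un[OF x0] by (auto simp: continuous_map_def forget_conf_def)
  have "induced_image X ?D f x0 \<subseteq> induced_image ?M ?D forget_conf (?P x0)"
    unfolding induced_image_eq[OF cf] induced_image_eq[OF continuous_map_forget_conf] c(2)
  proof (rule image_subsetI)
    fix p assume p: "p \<in> loops_at X x0"
    have "p t \<in> topspace X" if "t \<in> {0..1}" for t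
      using p that unfolding loops_at_def pathin_def by (auto simp: continuous_map_def)
    then have "(f \<circ> p) t = (forget_conf \<circ> (?P \<circ> p)) t" if "t \<in> {0..1}" for t
      using that Un by (simp add: forget_conf_def)
    then have "loop_class ?D (f x0) (f \<circ> p) = loop_class ?D (f x0) (forget_conf \<circ> (?P \<circ> p))"
      by (intro loop_class_eqI loop_homotopic_equal loops_at_compose[OF p cf])
    then show "loop_class ?D (f x0) (f \<circ> p) \<in>
        (\<lambda>p. loop_class ?D (f x0) (forget_conf \<circ> p)) ` loops_at ?M (?P x0)"
      using loops_at_compose[OF p P] by blast
  qed
  moreover have "subgroup (induced_image ?M ?D forget_conf (?P x0)) (fundamental_group ?D (f x0))"
    using subgroup_induced_image[OF continuous_map_forget_conf c(1)] unfolding c(2) .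
  moreover have "group (fundamental_group ?D (f x0))"
    by (rule group_fundamental_group) (use cf x0 in \<open>auto simp: continuous_map_def\<close>)
  ultimately show ?thesis
    unfolding image_in_mixed_braids_def using c subgroup_induced_image[OF cf x0]
    by (blast intro: group.subgroup_incl)
qed

section \<open>From mixed braid groups to a partition\<close>

text \<open>Simplices are closed and convex, a finite union of such sets is an absolute
  neighbourhood retract, and these retracts are locally path connected.\<close>

lemma locally_path_connected_finite_polyhedron:
  assumes "finite_polyhedron X"
  shows "locally path_connected X"
proof -
  obtain \<C> where \<C>: "simplicial_complex \<C>" "X = \<Union>\<C>"
    using assms unfolding finite_polyhedron_def by blast
  have "ANR (\<Union>\<C>)"
    by (rule ANR_finite_Union_convex_closed)
      (use \<C>(1) in \<open>auto simp: simplicial_complex_def dest: closed_simplex convex_simplex\<close>)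
  then show ?thesis
    unfolding \<C>(2) by (rule ANR_imp_locally_path_connected)
qed

text \<open>By \<open>mixed_braid_monodromy\<close> the set \<open>fst (c x0)\<close> is invariant.
  Choices of \<open>c\<close> in different path components need no compatibility; only the common
  \<open>m\<close> and \<open>l\<close> tie the components together.\<close>

lemma proper_partition_of_mixed_braids:
  fixes X S :: "'a::real_normed_vector set" and Y :: "'b::real_normed_vector set"
  assumes X: "locally path_connected X" and S: "base_points X S"
    and f: "nvalued_map (m + l) (top_of_set X) (top_of_set Y) f" and ml: "0 < m" "0 < l"
    and braids: "\<And>x0. x0 \<in> S \<Longrightarrow> image_in_mixed_braids m l (top_of_set X) (top_of_set Y) f x0"
  shows "has_proper_partition (m + l) (top_of_set X) (top_of_set Y) f"
proof -
  let ?Y = "top_of_set Y"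
  let ?M = "mixed_conf m l ?Y" and ?D = "unordered_conf (m + l) ?Y"
  have "\<exists>c. c \<in> topspace ?M \<and> forget_conf c = f x0 \<and>
      induced_image (top_of_set X) ?D f x0 \<subseteq> induced_image ?M ?D forget_conf c" if "x0 \<in> S" for x0
  proof -
    obtain c where c: "c \<in> topspace ?M" "forget_conf c = f x0"
      "subgroup (induced_image (top_of_set X) ?D f x0)
        (fundamental_group ?D (f x0) \<lparr>carrier := induced_image ?M ?D forget_conf c\<rparr>)"
      using braids[OF \<open>x0 \<in> S\<close>] unfolding image_in_mixed_braids_def by blast
    then show ?thesis using subgroup.subset[OF c(3)] by (intro exI[of _ c]) simp
  qed
  then obtain c where c: "\<And>x0. x0 \<in> S \<Longrightarrow> c x0 \<in> topspace ?M"
    "\<And>x0. x0 \<in> S \<Longrightarrow> forget_conf (c x0) = f x0"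
    "\<And>x0. x0 \<in> S \<Longrightarrow> induced_image (top_of_set X) ?D f x0 \<subseteq> induced_image ?M ?D forget_conf (c x0)"
    by metis
  \<comment> \<open>\<open>S\<close> may meet a path component several times, with incompatible choices of \<open>c\<close>; \<open>r\<close> selects
    one base point for each component.\<close>
  define r where "r x = (SOME x0. x0 \<in> S \<and> path_component X x0 x)" for x
  have r: "r x \<in> S" "path_component X (r x) x" if "x \<in> X" for x
  proof -
    have "\<exists>x0. x0 \<in> S \<and> path_component X x0 x"
      using S that unfolding base_points_def by blast
    then show "r x \<in> S" "path_component X (r x) x"
      unfolding r_def by (rule someI2_ex; blast)+
  qed
  have fst_c: "card (fst (c x0)) = m" if "x0 \<in> S" for x0
  proof -
    have "fst (c x0) \<in> topspace (unordered_conf m ?Y)"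
      using c(1)[OF that] continuous_map_mixed_conf_fst[of m l ?Y] unfolding continuous_map_def by blast
    then show ?thesis by (simp add: topspace_unordered_conf)
  qed
  show ?thesis
  proof (rule proper_partition_of_invariant_sets[OF f X, where r=r and A="\<lambda>x0. fst (c x0)"])
    \<comment> \<open>For \<open>x\<close> and \<open>x'\<close> in one path component the
      predicates under the choice operator are equal, hence so are the chosen points.\<close>
    show "r x = r x'" if "path_component X x x'" for x x'
      unfolding r_def using that path_component_trans path_component_sym
      by (intro arg_cong[where f=Eps]) blast
    show "fst (c (r x)) \<subseteq> f (r x)" if "x \<in> X" for x
      using c(2)[OF r(1)[OF that]] by (auto simp: forget_conf_def)
    show "b \<in> fst (c (r x))" if "x \<in> X" "a \<in> fst (c (r x))"
      "path_component (Sigma X f) (r x, a) (r x, b)" for x a b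
      by (rule mixed_braid_monodromy[OF f ml(1) _ _ _ that(2,3)]) (use c r(1)[OF that(1)] in auto)
  qed (use r fst_c ml in auto)
qed

text \<open>\<open>X\<close> may be disconnected, so the condition is imposed at base points meeting
  every path component. The numbers \<open>m\<close> and \<open>l\<close> are chosen before the base
  point because each map of a partition has the same number of values everywhere.\<close>

theorem theorem3p3:
  fixes X S :: "'a::euclidean_space set" and Y :: "'b::euclidean_space set"
    and f :: "'a \<Rightarrow> 'b set" and n :: nat
  assumes "finite_polyhedron X" and "finite_polyhedron Y"
    and "base_points X S"
    and "nvalued_map n (top_of_set X) (top_of_set Y) f"
  shows "has_proper_partition n (top_of_set X) (top_of_set Y) f \<longleftrightarrow>
    (\<exists>m l. 0 < m \<and> 0 < l \<and> m + l = n \<and>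
      (\<forall>x0\<in>S. image_in_mixed_braids m l (top_of_set X) (top_of_set Y) f x0))"
proof
  assume "has_proper_partition n (top_of_set X) (top_of_set Y) f"
  have Y: "Hausdorff_space (top_of_set Y)" by (simp add: Hausdorff_space_subtopology)
  obtain m l G H where ml: "0 < m" "0 < l" "m + l = n"
    and GH: "nvalued_map m (top_of_set X) (top_of_set Y) G" "nvalued_map l (top_of_set X) (top_of_set Y) H"
    "\<And>x. x \<in> topspace (top_of_set X) \<Longrightarrow> f x = G x \<union> H x"
    "\<And>x. x \<in> topspace (top_of_set X) \<Longrightarrow> G x \<inter> H x = {}"
    by (rule proper_partition_two[OF Y assms(4) \<open>has_proper_partition n _ _ f\<close>]) blast
  have f: "nvalued_map (m + l) (top_of_set X) (top_of_set Y) f" using assms(4) ml by simp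
  have "image_in_mixed_braids m l (top_of_set X) (top_of_set Y) f x0" if "x0 \<in> S" for x0
    by (rule image_in_mixed_braids_of_partition[OF Y _ f GH])
      (use assms(3) that in \<open>auto simp: base_points_def\<close>)
  with ml show "\<exists>m l. 0 < m \<and> 0 < l \<and> m + l = n \<and>
      (\<forall>x0\<in>S. image_in_mixed_braids m l (top_of_set X) (top_of_set Y) f x0)" by blast
next
  assume "\<exists>m l. 0 < m \<and> 0 < l \<and> m + l = n \<and>
      (\<forall>x0\<in>S. image_in_mixed_braids m l (top_of_set X) (top_of_set Y) f x0)"
  then obtain m l where ml: "0 < m" "0 < l" "m + l = n"
    "\<And>x0. x0 \<in> S \<Longrightarrow> image_in_mixed_braids m l (top_of_set X) (top_of_set Y) f x0" by blast
  show "has_proper_partition n (top_of_set X) (top_of_set Y) f"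
    using proper_partition_of_mixed_braids[OF locally_path_connected_finite_polyhedron[OF assms(1)] assms(3) _ ml(1,2,4)]
      assms(4) ml(3) by simp
qed

end
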